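(* Let $K,G,m_0,A_g,B_g,\bar f_c,\bar f_t>0$, $e\in[0.5,1]$, $m_g'(p)=A_g e^{\frac{p-\bar f_t/3}{B_g\bar f_c}}$, $\hat f(p,\varrho,\varrho_e)=\frac32\left(\frac{\varrho}{\bar f_c}\right)^2+m_0\left(\frac{\varrho_e}{\sqrt6\bar f_c}+\frac{p}{\bar f_c}\right)-1$, and $\mathbb D_e=K\mathbf I\otimes\mathbf I+2G\mathbb I_{dev}$. Fix $\boldsymbol\varepsilon^p_{k-1}\in\mathbb R^{3\times3}_{sym}$. For $\boldsymbol\varepsilon\in\mathbb R^{3\times3}_{sym}$ let $\boldsymbol\sigma^{tr}=\mathbb D_e:(\boldsymbol\varepsilon-\boldsymbol\varepsilon^p_{k-1})$ and define $\mathbf T(\boldsymbol\varepsilon)=\boldsymbol\sigma^{tr}$ if $\hat f(p(\boldsymbol\sigma^{tr}),\varrho(\boldsymbol\sigma^{tr}),\varrho_e(\boldsymbol\sigma^{tr}))\le0$, and otherwise $\mathbf T(\boldsymbol\varepsilon)=\boldsymbol\sigma$, where $(\boldsymbol\sigma,\triangle\lambda)$ is the unique solution of: $\boldsymbol\sigma=\boldsymbol\sigma^{tr}-\triangle\lambda\big[K\frac{m_g'(p(\boldsymbol\sigma))}{\bar f_c}\mathbf I+2G\big(\frac{3\varrho(\boldsymbol\sigma)}{\bar f_c^2}+\frac{m_0}{\sqrt6\bar f_c}\big)\hat{\mathbf n}\big]$ for some $\hat{\mathbf n}\in\partial\varrho(\boldsymbol\sigma)$, $\triangle\lambda\ge0$,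 $\hat f(p(\boldsymbol\sigma),\varrho(\boldsymbol\sigma),\varrho_e(\boldsymbol\sigma))\le0$, $\triangle\lambda\,\hat f(p(\boldsymbol\sigma),\varrho(\boldsymbol\sigma),\varrho_e(\boldsymbol\sigma))=0$. Then $\mathbf T$ is strongly semismooth on $\mathbb R^{3\times3}_{sym}$ as a function of $\boldsymbol\varepsilon$.
   Context: $\mathbb R^{3\times3}_{sym}$: real symmetric $3\times3$ matrices with Frobenius product ":" and norm; $\mathbf I$ identity; $\mathbb I_{dev}:\boldsymbol\sigma=\boldsymbol\sigma-\frac13(\mathbf I:\boldsymbol\sigma)\mathbf I$, $(\mathbf I\otimes\mathbf I):\boldsymbol\sigma=(\mathbf I:\boldsymbol\sigma)\mathbf I$. $p(\boldsymbol\sigma)=\frac13\mathbf I:\boldsymbol\sigma$, $\mathbf s(\boldsymbol\sigma)=\mathbb I_{dev}:\boldsymbol\sigma$, $\varrho(\boldsymbol\sigma)=\|\mathbf s(\boldsymbol\sigma)\|$; for $\varrho(\boldsymbol\sigma)>0$, $\theta(\boldsymbol\sigma)=\frac13\arccos\big(\frac{3\sqrt3}{2}J_3/J_2^{3/2}\big)$ with $J_2=\frac12\mathbf s:\mathbf s$, $J_3=\frac13\mathbf s^3:\mathbf I$. $r_e(\cos\theta)=\frac{4(1-e^2)\cos^2\theta+(2e-1)^2}{2(1-e^2)\cos\theta+(2e-1)\sqrt{4(1-e^2)\cos^2\theta+5e^2-4e}}$; $\varrho_e(\boldsymbol\sigma)=\varrho(\boldsymbol\sigma)r_e(\cos\theta(\boldsymbol\sigma))$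 if $\varrho(\boldsymbol\sigma)>0$ and $0$ otherwise. $\partial\varrho(\boldsymbol\sigma)=\{\mathbf s(\boldsymbol\sigma)/\varrho(\boldsymbol\sigma)\}$ if $\varrho(\boldsymbol\sigma)>0$, and $\{\hat{\mathbf n}\in\mathbb R^{3\times3}_{sym}:\mathbf I:\hat{\mathbf n}=0,\|\hat{\mathbf n}\|\le1\}$ if $\varrho(\boldsymbol\sigma)=0$. A function $F$ between finite-dimensional spaces is strongly semismooth at $x$ if it is locally Lipschitz near $x$, directionally differentiable at $x$, and $F(x+h)-F(x)-Vh=O(\|h\|^2)$ for all $V\in\partial F(x+h)$ (Clarke generalized Jacobian) as $h\to0$; strongly semismooth on a set if at every point. *)

theory Defs
  imports "HOL-Analysis.Analysis"
begin

text \<open>3x3 real matrices are modelled as real^3^3; the Euclidean inner product and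
norm on this type are exactly the Frobenius product and norm.\<close>

type_synonym mat3 = "real^3^3"

definition Sym3 :: "mat3 set" where
  "Sym3 = {A. transpose A = A}"

definition Id3 :: mat3 where "Id3 = mat 1"

definition frob :: "mat3 \<Rightarrow> mat3 \<Rightarrow> real" (infixl ":\<^sub>F" 70) where
  "frob A B = A \<bullet> B"

definition pres :: "mat3 \<Rightarrow> real" where
  "pres \<sigma> = (1/3) * (Id3 :\<^sub>F \<sigma>)"

definition devp :: "mat3 \<Rightarrow> mat3" where
  "devp \<sigma> = \<sigma> - ((1/3) * (Id3 :\<^sub>F \<sigma>)) *\<^sub>R Id3"

definition rho :: "mat3 \<Rightarrow> real" where
  "rho \<sigma> = norm (devp \<sigma>)"

definition J2 :: "mat3 \<Rightarrow> real" where
  "J2 \<sigma> = (1/2) * (devp \<sigma> :\<^sub>F devp \<sigma>)"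

definition J3 :: "mat3 \<Rightarrow> real" where
  "J3 \<sigma> = (1/3) * ((devp \<sigma> ** devp \<sigma> ** devp \<sigma>) :\<^sub>F Id3)"

definition lode :: "mat3 \<Rightarrow> real" where
  "lode \<sigma> = (1/3) * arccos ((3 * sqrt 3 / 2) * J3 \<sigma> / (J2 \<sigma> powr (3/2)))"

definition r_e :: "real \<Rightarrow> real \<Rightarrow> real" where
  "r_e e c = (4 * (1 - e\<^sup>2) * c\<^sup>2 + (2*e - 1)\<^sup>2) /
     (2 * (1 - e\<^sup>2) * c + (2*e - 1) * sqrt (4 * (1 - e\<^sup>2) * c\<^sup>2 + 5 * e\<^sup>2 - 4 * e))"

definition rho_e :: "real \<Rightarrow> mat3 \<Rightarrow> real" where
  "rho_e e \<sigma> = (if rho \<sigma> > 0 then rho \<sigma> * r_e e (cos (lode \<sigma>)) else 0)"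

definition subdiff_rho :: "mat3 \<Rightarrow> mat3 set" where
  "subdiff_rho \<sigma> = (if rho \<sigma> > 0 then {(1 / rho \<sigma>) *\<^sub>R devp \<sigma>}
      else {n. n \<in> Sym3 \<and> Id3 :\<^sub>F n = 0 \<and> norm n \<le> 1})"

definition mg' :: "real \<Rightarrow> real \<Rightarrow> real \<Rightarrow> real \<Rightarrow> real \<Rightarrow> real" where
  "mg' Ag Bg fc ft p = Ag * exp ((p - ft / 3) / (Bg * fc))"

definition fhat :: "real \<Rightarrow> real \<Rightarrow> real \<Rightarrow> real \<Rightarrow> real \<Rightarrow> real" where
  "fhat m0 fc p r re = (3/2) * (r / fc)\<^sup>2 + m0 * (re / (sqrt 6 * fc) + p / fc) - 1"

definition De :: "real \<Rightarrow> real \<Rightarrow> mat3 \<Rightarrow> mat3" where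
  "De K G \<sigma> = (K * (Id3 :\<^sub>F \<sigma>)) *\<^sub>R Id3 + (2 * G) *\<^sub>R devp \<sigma>"

definition return_system ::
  "real \<Rightarrow> real \<Rightarrow> real \<Rightarrow> real \<Rightarrow> real \<Rightarrow> real \<Rightarrow> real \<Rightarrow> real \<Rightarrow> mat3 \<Rightarrow> mat3 \<Rightarrow> real \<Rightarrow> bool" where
  "return_system K G m0 Ag Bg fc ft e \<sigma>tr \<sigma> dl \<longleftrightarrow>
     \<sigma> \<in> Sym3 \<and>
     (\<exists>n \<in> subdiff_rho \<sigma>.
        \<sigma> = \<sigma>tr - dl *\<^sub>R ((K * mg' Ag Bg fc ft (pres \<sigma>) / fc) *\<^sub>R Id3
              + (2 * G * (3 * rho \<sigma> / fc\<^sup>2 + m0 / (sqrt 6 * fc))) *\<^sub>R n)) \<and>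
     dl \<ge> 0 \<and>
     fhat m0 fc (pres \<sigma>) (rho \<sigma>) (rho_e e \<sigma>) \<le> 0 \<and>
     dl * fhat m0 fc (pres \<sigma>) (rho \<sigma>) (rho_e e \<sigma>) = 0"

definition Tmap ::
  "real \<Rightarrow> real \<Rightarrow> real \<Rightarrow> real \<Rightarrow> real \<Rightarrow> real \<Rightarrow> real \<Rightarrow> real \<Rightarrow> mat3 \<Rightarrow> mat3 \<Rightarrow> mat3" where
  "Tmap K G m0 Ag Bg fc ft e epsp \<epsilon> =
     (let \<sigma>tr = De K G (\<epsilon> - epsp) in
      if fhat m0 fc (pres \<sigma>tr) (rho \<sigma>tr) (rho_e e \<sigma>tr) \<le> 0 then \<sigma>tr
      else fst (THE sl. return_system K G m0 Ag Bg fc ft e \<sigma>tr (fst sl) (snd sl)))"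

text \<open>Clarke generalized Jacobian of F restricted to a linear subspace S (the domain).
 Maps V are only relevant through their values on S.\<close>

definition B_jac :: "'a::euclidean_space set \<Rightarrow> ('a \<Rightarrow> 'b::euclidean_space) \<Rightarrow> 'a \<Rightarrow> ('a \<Rightarrow> 'b) set" where
  "B_jac S F x = {V. linear V \<and>
     (\<exists>xs D. (\<forall>k. xs k \<in> S \<and> (F has_derivative D k) (at (xs k) within S)) \<and>
             xs \<longlonglongrightarrow> x \<and> (\<forall>h\<in>S. (\<lambda>k. D k h) \<longlonglongrightarrow> V h))}"

definition clarke_jac :: "'a::euclidean_space set \<Rightarrow> ('a \<Rightarrow> 'b::euclidean_space) \<Rightarrow> 'a \<Rightarrow> ('a \<Rightarrow> 'b) set" where
  "clarke_jac S F x = {V. \<exists>(n::nat) c Vs.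
      (\<forall>i<n. c i \<ge> (0::real) \<and> Vs i \<in> B_jac S F x) \<and> (\<Sum>i<n. c i) = 1 \<and>
      (\<forall>h\<in>S. V h = (\<Sum>i<n. c i *\<^sub>R Vs i h))}"

definition strongly_semismooth_at :: "'a::euclidean_space set \<Rightarrow> ('a \<Rightarrow> 'b::euclidean_space) \<Rightarrow> 'a \<Rightarrow> bool" where
  "strongly_semismooth_at S F x \<longleftrightarrow>
     (\<exists>r>0. \<exists>L. \<forall>y\<in>S \<inter> ball x r. \<forall>z\<in>S \<inter> ball x r. dist (F y) (F z) \<le> L * dist y z) \<and>
     (\<forall>h\<in>S. \<exists>d. ((\<lambda>t. (1 / t) *\<^sub>R (F (x + t *\<^sub>R h) - F x)) \<longlongrightarrow> d) (at_right 0)) \<and>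
     (\<exists>C \<delta>. \<delta> > 0 \<and> (\<forall>h\<in>S. 0 < norm h \<and> norm h < \<delta> \<longrightarrow>
        (\<forall>V\<in>clarke_jac S F (x + h). norm (F (x + h) - F x - V h) \<le> C * (norm h)\<^sup>2)))"

definition strongly_semismooth_on :: "'a::euclidean_space set \<Rightarrow> ('a \<Rightarrow> 'b::euclidean_space) \<Rightarrow> bool" where
  "strongly_semismooth_on S F \<longleftrightarrow> (\<forall>x\<in>S. strongly_semismooth_at S F x)"

end

theory Submission
  imports Defs
begin

text \<open>
  By convexity of the estimate and a limit argument, strong semismoothness only needs the bound
  \<open>F y - F x - F'(y; y - x) = O(\<parallel>y - x\<parallel>\<^sup>2)\<close> for one-sided directional derivatives.  This
  property, here \<open>ssd_at\<close>, is stable under composition and under solving a scalar equation that is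
  strongly monotone in its unknown.

  The flow rule keeps the direction of the trial deviator, hence its Lode angle, and the volumetric
  equation expresses \<open>\<triangle>\<lambda>\<close> explicitly through the pressure \<open>p\<close> of the result.  As \<open>p\<close> increases,
  \<open>\<triangle>\<lambda>\<close> decreases and the deviator grows, so the yield function increases in \<open>p\<close> with slope at
  least \<open>m0 / fc\<close>; its root \<open>p*\<close> is semismooth, and the returned pressure is
  \<open>min p\<^sub>t\<^sub>r p*\<close> in the elastic and the plastic regime alike.

  The only other non-smooth ingredients are positively homogeneous Lipschitz functions at the apex and
  \<open>\<rho>\<^sub>e\<close> where the Lode angle has square root singularities.  There one uses
  \<open>cos \<theta> = sqrt (3/2) * \<lambda>\<^sub>m\<^sub>a\<^sub>x(s) / \<rho>\<close> and the strong semismoothness of the largest eigenvalue.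
\<close>

section \<open>Directional derivatives\<close>

text \<open>Derivatives are taken at the moving point \<open>y\<close> along \<open>y - x\<close>,
  not at \<open>x\<close>, because the Clarke Jacobian at \<open>x + h\<close> is built from
  derivatives at points near \<open>x + h\<close>. The main obstacle is the apex: the unit deviator
  is discontinuous at \<open>0\<close>, so the returned deviator cannot be handled as amplitude
  times direction. Instead it is written through \<open>soft\<close>, a function of the pair (trial
  deviator, threshold). On this product space it is positively homogeneous and globally Lipschitz,
  and away from the origin it is either a quotient of semismooth functions or locally trivial, so
  the apex becomes a single point where homogeneity settles everything. Every ingredient is a total
  function on all 3x3 matrices: \<open>qmax\<close> is defined by a quadratic form, and the
  denominators are bounded below. The calculus therefore runs on the full space, and symmetry
  matters only when this extension is identified with \<open>Tmap\<close>. The largest eigenvalue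
  replaces the Lode angle because it is convex and solves the cubic whose normalised form is the
  triple-angle formula.\<close>

definition has_dir_deriv ::
  "('a::real_normed_vector \<Rightarrow> 'b::real_normed_vector) \<Rightarrow> 'a \<Rightarrow> 'a \<Rightarrow> 'b \<Rightarrow> bool" where
  "has_dir_deriv F x v d \<longleftrightarrow> ((\<lambda>t. (1 / t) *\<^sub>R (F (x + t *\<^sub>R v) - F x)) \<longlongrightarrow> d) (at_right 0)"

lemma has_dir_deriv_unique:
  "has_dir_deriv F x v d \<Longrightarrow> has_dir_deriv F x v d' \<Longrightarrow> d = d'"
  unfolding has_dir_deriv_def by (rule tendsto_unique[OF trivial_limit_at_right_real])

lemma tendsto_ray:
  fixes x v :: "'a::real_normed_vector"
  shows "((\<lambda>t. x + t *\<^sub>R v) \<longlongrightarrow> x) (at_right (0::real))"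
proof -
  have "((\<lambda>t. x + t *\<^sub>R v) \<longlongrightarrow> x + 0 *\<^sub>R v) (at_right (0::real))"
    by (intro tendsto_intros)
  then show ?thesis by simp
qed

lemma eventually_ray_in_ball:
  fixes x v :: "'a::real_normed_vector"
  assumes "r > 0"
  shows "\<forall>\<^sub>F t in at_right (0::real). x + t *\<^sub>R v \<in> ball x r"
  using topological_tendstoD[OF tendsto_ray open_ball, of x x r v] assms by simp

lemma eventually_right_pos: "\<forall>\<^sub>F t in at_right (0::real). t > 0"
  by (simp add: eventually_at_right_less)

lemma norm_quotient_le:
  assumes "norm z \<le> t * c" "t > 0"
  shows "norm ((1 / t) *\<^sub>R z) \<le> c"
  using assms by (simp add: divide_simps mult.commute)

lemma has_dir_deriv_zero: "has_dir_deriv F x 0 0"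
  unfolding has_dir_deriv_def by simp

text \<open>The two difference quotients already differ by at most \<open>L * norm (v - w)\<close>
  for small \<open>t\<close>. This permits exchanging a direction for a nearby one in later
  remainder estimates.\<close>

lemma has_dir_deriv_lipschitz:
  assumes d: "has_dir_deriv F x v d" and d': "has_dir_deriv F x w d'"
    and L: "L-lipschitz_on (ball x r) F" and r: "r > 0"
  shows "norm (d - d') \<le> L * norm (v - w)"
proof -
  have lim: "((\<lambda>t. norm ((1 / t) *\<^sub>R (F (x + t *\<^sub>R v) - F x) - (1 / t) *\<^sub>R (F (x + t *\<^sub>R w) - F x)))
      \<longlongrightarrow> norm (d - d')) (at_right 0)"
    using d d' unfolding has_dir_deriv_def by (intro tendsto_norm tendsto_diff)
  have "\<forall>\<^sub>F t in at_right 0. norm ((1 / t) *\<^sub>R (F (x + t *\<^sub>R v) - F x) - (1 / t) *\<^sub>R (F (x + t *\<^sub>R w) - F x))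
      \<le> L * norm (v - w)"
    using eventually_ray_in_ball[OF r, of x v] eventually_ray_in_ball[OF r, of x w] eventually_right_pos
  proof eventually_elim
    case (elim t)
    have "norm (F (x + t *\<^sub>R v) - F (x + t *\<^sub>R w)) \<le> L * norm ((x + t *\<^sub>R v) - (x + t *\<^sub>R w))"
      using lipschitz_onD[OF L elim(1,2)] by (simp add: dist_norm)
    also have "(x + t *\<^sub>R v) - (x + t *\<^sub>R w) = t *\<^sub>R (v - w)" by (simp add: algebra_simps)
    finally have "norm (F (x + t *\<^sub>R v) - F (x + t *\<^sub>R w)) \<le> t * (L * norm (v - w))"
      using elim(3) by (simp add: ac_simps)
    moreover have "(1 / t) *\<^sub>R (F (x + t *\<^sub>R v) - F x) - (1 / t) *\<^sub>R (F (x + t *\<^sub>R w) - F x)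
        = (1 / t) *\<^sub>R (F (x + t *\<^sub>R v) - F (x + t *\<^sub>R w))"
      by (simp add: scaleR_diff_right[symmetric])
    ultimately show ?case using norm_quotient_le elim(3) by metis
  qed
  from tendsto_upperbound[OF lim this] show ?thesis by simp
qed

lemma has_dir_deriv_lipschitz_bound:
  assumes "has_dir_deriv F x v d" "L-lipschitz_on (ball x r) F" "r > 0"
  shows "norm d \<le> L * norm v"
  using has_dir_deriv_lipschitz[OF assms(1) has_dir_deriv_zero assms(2,3)] by simp

lemma tendsto_of_dir_deriv:
  assumes "has_dir_deriv F x v d"
  shows "((\<lambda>t. F (x + t *\<^sub>R v)) \<longlongrightarrow> F x) (at_right 0)"
proof -
  have "((\<lambda>t. F x + t *\<^sub>R ((1 / t) *\<^sub>R (F (x + t *\<^sub>R v) - F x))) \<longlongrightarrow> F x + 0 *\<^sub>R d) (at_right 0)"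
    using assms unfolding has_dir_deriv_def by (intro tendsto_intros)
  then have "((\<lambda>t. F x + t *\<^sub>R ((1 / t) *\<^sub>R (F (x + t *\<^sub>R v) - F x))) \<longlongrightarrow> F x) (at_right 0)" by simp
  then show ?thesis
    by (rule Lim_transform_eventually) (use eventually_right_pos in eventually_elim, simp)
qed

text \<open>Lipschitz continuity of \<open>G\<close> allows the curve
  \<open>F (x + t *\<^sub>R v)\<close> to be replaced by the ray \<open>F x + t *\<^sub>R d\<close>;
  after division by \<open>t\<close> the error is \<open>L * norm (?q t - d)\<close>, which
  vanishes.\<close>

lemma has_dir_deriv_compose:
  assumes F: "has_dir_deriv F x v d" and G: "has_dir_deriv G (F x) d d'"
    and L: "L-lipschitz_on (ball (F x) r) G" and r: "r > 0"
  shows "has_dir_deriv (\<lambda>x. G (F x)) x v d'"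
proof -
  let ?q = "\<lambda>t. (1 / t) *\<^sub>R (F (x + t *\<^sub>R v) - F x)"
  have ev: "\<forall>\<^sub>F t in at_right 0. norm ((1 / t) *\<^sub>R (G (F (x + t *\<^sub>R v)) - G (F x)) - (1 / t) *\<^sub>R (G (F x + t *\<^sub>R d) - G (F x)))
      \<le> L * norm (?q t - d)"
    using topological_tendstoD[OF tendsto_of_dir_deriv[OF F] open_ball, of "F x" r, simplified, OF r]
      eventually_ray_in_ball[OF r, of "F x" d] eventually_right_pos
  proof eventually_elim
    case (elim t)
    have "norm (G (F (x + t *\<^sub>R v)) - G (F x + t *\<^sub>R d)) \<le> L * norm (F (x + t *\<^sub>R v) - (F x + t *\<^sub>R d))"
      using lipschitz_onD[OF L _ elim(2)] elim(1) by (simp add: dist_norm norm_minus_commute)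
    also have "F (x + t *\<^sub>R v) - (F x + t *\<^sub>R d) = t *\<^sub>R (?q t - d)"
      using elim(3) by (simp add: algebra_simps)
    finally have "norm (G (F (x + t *\<^sub>R v)) - G (F x + t *\<^sub>R d)) \<le> t * (L * norm (?q t - d))"
      using elim(3) by (simp add: ac_simps)
    moreover have "(1 / t) *\<^sub>R (G (F (x + t *\<^sub>R v)) - G (F x)) - (1 / t) *\<^sub>R (G (F x + t *\<^sub>R d) - G (F x))
        = (1 / t) *\<^sub>R (G (F (x + t *\<^sub>R v)) - G (F x + t *\<^sub>R d))"
      by (simp add: scaleR_diff_right[symmetric])
    ultimately show ?case using norm_quotient_le elim(3) by metis
  qed
  have "((\<lambda>t. L * norm (?q t - d)) \<longlongrightarrow> L * norm (d - d)) (at_right 0)"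
    using F unfolding has_dir_deriv_def by (intro tendsto_intros)
  then have "((\<lambda>t. L * norm (?q t - d)) \<longlongrightarrow> 0) (at_right 0)" by simp
  from Lim_transform[OF G[unfolded has_dir_deriv_def] Lim_null_comparison[OF ev this]] show ?thesis
    unfolding has_dir_deriv_def .
qed

lemma has_dir_deriv_cong:
  assumes "has_dir_deriv F x v d" "r > 0" "\<And>y. y \<in> ball x r \<Longrightarrow> F y = G y"
  shows "has_dir_deriv G x v d"
  using assms(1) unfolding has_dir_deriv_def
  by (rule Lim_transform_eventually)
    (use eventually_ray_in_ball[OF assms(2), of x v] in eventually_elim, simp add: assms(2,3))

lemma has_dir_deriv_Pair:
  assumes "has_dir_deriv F x v d" "has_dir_deriv G x v d'"
  shows "has_dir_deriv (\<lambda>x. (F x, G x)) x v (d, d')"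
  using tendsto_Pair[OF assms[unfolded has_dir_deriv_def]] unfolding has_dir_deriv_def by simp

text \<open>Only the line through \<open>x\<close> along \<open>v\<close> has to lie in
  \<open>S\<close>, which suits the relative derivatives on a subspace used by
  \<open>B_jac\<close>.\<close>

lemma has_derivative_imp_has_dir_deriv:
  assumes F: "(F has_derivative D) (at x within S)" and S: "\<And>t. x + t *\<^sub>R v \<in> S"
  shows "has_dir_deriv F x v (D v)"
proof -
  have lin: "bounded_linear D" using F by (rule has_derivative_bounded_linear)
  have "((\<lambda>t. F (x + t *\<^sub>R v)) has_derivative (\<lambda>t. D (t *\<^sub>R v))) (at (0::real))"
  proof (rule has_derivative_in_compose[where f' = "\<lambda>t. t *\<^sub>R v" and g' = D])
    show "((\<lambda>t. x + t *\<^sub>R v) has_derivative (\<lambda>t. t *\<^sub>R v)) (at 0)"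
      by (auto intro!: derivative_eq_intros)
    show "(F has_derivative D) (at (x + 0 *\<^sub>R v) within range (\<lambda>t. x + t *\<^sub>R v))"
      using F S by (auto intro: has_derivative_subset)
  qed
  then have "((\<lambda>t. F (x + t *\<^sub>R v)) has_vector_derivative D v) (at 0)"
    unfolding has_vector_derivative_def by (simp add: bounded_linear.linear[OF lin] linear_cmul)
  then have "((\<lambda>t. F (x + t *\<^sub>R v)) has_vector_derivative D v) (at_right 0)"
    by (rule has_vector_derivative_at_within)
  then have "((\<lambda>t. (F (x + t *\<^sub>R v) - F x - t *\<^sub>R D v) /\<^sub>R norm t) \<longlongrightarrow> 0) (at_right 0)"
    by (simp add: has_vector_derivative_def has_derivative_within diff_diff_eq divide_inverse)
  then have "((\<lambda>t. (1 / t) *\<^sub>R (F (x + t *\<^sub>R v) - F x) - D v) \<longlongrightarrow> 0) (at_right 0)"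
    by (rule Lim_transform_eventually)
      (use eventually_right_pos in eventually_elim, simp add: algebra_simps divide_inverse)
  then show ?thesis
    unfolding has_dir_deriv_def by (rule LIM_zero_cancel)
qed

section \<open>Strong semismoothness through directional derivatives\<close>

text \<open>Directional derivatives are demanded in every direction at every nearby point, since in
  a composition the outer function is differentiated along a derivative of the inner one.
  Quantifying over all \<open>d\<close> in the last clause is harmless because such a
  \<open>d\<close> is unique.\<close>

definition ssd_at ::
  "('a::real_normed_vector \<Rightarrow> 'b::real_normed_vector) \<Rightarrow> 'a \<Rightarrow> bool" where
  "ssd_at F x \<longleftrightarrow> (\<exists>r L C. r > 0 \<and> C \<ge> 0 \<and> L-lipschitz_on (ball x r) F \<and>
     (\<forall>y\<in>ball x r. \<forall>v. \<exists>d. has_dir_deriv F y v d) \<and>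
     (\<forall>y\<in>ball x r. \<forall>d. has_dir_deriv F y (y - x) d \<longrightarrow>
        norm (F y - F x - d) \<le> C * (norm (y - x))\<^sup>2))"

lemma ssd_atI:
  assumes "r > 0" "C \<ge> 0" "L-lipschitz_on (ball x r) F"
    "\<And>y v. y \<in> ball x r \<Longrightarrow> \<exists>d. has_dir_deriv F y v d"
    "\<And>y d. y \<in> ball x r \<Longrightarrow> has_dir_deriv F y (y - x) d \<Longrightarrow>
        norm (F y - F x - d) \<le> C * (norm (y - x))\<^sup>2"
  shows "ssd_at F x"
  unfolding ssd_at_def using assms by blast

lemma ssd_atE:
  assumes "ssd_at F x"
  obtains r L C where "r > 0" "C \<ge> 0" "L-lipschitz_on (ball x r) F"
    "\<And>y v. y \<in> ball x r \<Longrightarrow> \<exists>d. has_dir_deriv F y v d"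
    "\<And>y d. y \<in> ball x r \<Longrightarrow> has_dir_deriv F y (y - x) d \<Longrightarrow>
        norm (F y - F x - d) \<le> C * (norm (y - x))\<^sup>2"
  using assms unfolding ssd_at_def by blast

lemma ssd_at_dir_deriv_ex: "ssd_at F x \<Longrightarrow> \<exists>d. has_dir_deriv F x v d"
  by (metis ssd_atE centre_in_ball)

lemma ssd_at_isCont: assumes "ssd_at F x" shows "isCont F x"
proof -
  obtain r L C where "r > 0" "L-lipschitz_on (ball x r) F" using assms by (rule ssd_atE)
  then show ?thesis
    by (metis centre_in_ball continuous_on_interior interior_ball lipschitz_on_continuous_on)
qed

lemma ball_in_ball_around:
  fixes x y :: "'a::metric_space"
  assumes "y \<in> ball x r"
  obtains s where "s > 0" "ball y s \<subseteq> ball x r"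
  using assms open_ball open_contains_ball by metis

lemma ssd_at_cong:
  fixes F G :: "'a::real_normed_vector \<Rightarrow> 'b::real_normed_vector"
  assumes F: "ssd_at F x" and e: "e > 0" and eq: "\<And>y. y \<in> ball x e \<Longrightarrow> F y = G y"
  shows "ssd_at G x"
proof -
  obtain r L C where r: "r > 0" "C \<ge> 0" "L-lipschitz_on (ball x r) F"
    and D: "\<And>y v. y \<in> ball x r \<Longrightarrow> \<exists>d. has_dir_deriv F y v d"
    and E: "\<And>y d. y \<in> ball x r \<Longrightarrow> has_dir_deriv F y (y - x) d \<Longrightarrow>
        norm (F y - F x - d) \<le> C * (norm (y - x))\<^sup>2"
    using F by (rule ssd_atE) blast
  let ?r = "min r e"
  have *: "has_dir_deriv F y v d \<longleftrightarrow> has_dir_deriv G y v d" if y: "y \<in> ball x ?r" for y v d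
  proof -
    obtain s where "s > 0" "ball y s \<subseteq> ball x ?r" using ball_in_ball_around[OF y] .
    with eq show ?thesis
      using has_dir_deriv_cong[of F y v d s G] has_dir_deriv_cong[of G y v d s F] by fastforce
  qed
  show ?thesis
  proof (rule ssd_atI[of ?r C L])
    have "L-lipschitz_on (ball x ?r) F"
      using r(3) by (rule lipschitz_on_subset) auto
    then show "L-lipschitz_on (ball x ?r) G"
      unfolding lipschitz_on_def using eq by auto
    show "\<exists>d. has_dir_deriv G y v d" if "y \<in> ball x ?r" for y v
      using D[of y v] *[OF that] that by auto
    show "norm (G y - G x - d) \<le> C * (norm (y - x))\<^sup>2"
      if y: "y \<in> ball x ?r" and d: "has_dir_deriv G y (y - x) d" for y d
      using E[of y d] *[OF y] y d eq[of x] eq[of y] e by auto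
  qed (use r e in auto)
qed

lemma ssd_at_compose:
  fixes F :: "'a::real_normed_vector \<Rightarrow> 'b::real_normed_vector"
    and G :: "'b \<Rightarrow> 'c::real_normed_vector"
  assumes G: "ssd_at G (F x)" and F: "ssd_at F x"
  shows "ssd_at (\<lambda>x. G (F x)) x"
proof -
  obtain r1 L1 C1 where r1: "r1 > 0" "C1 \<ge> 0" and L1: "L1-lipschitz_on (ball x r1) F"
    and D1: "\<And>y v. y \<in> ball x r1 \<Longrightarrow> \<exists>d. has_dir_deriv F y v d"
    and E1: "\<And>y d. y \<in> ball x r1 \<Longrightarrow> has_dir_deriv F y (y - x) d \<Longrightarrow>
        norm (F y - F x - d) \<le> C1 * (norm (y - x))\<^sup>2"
    using F by (rule ssd_atE) blast
  obtain r2 L2 C2 where r2: "r2 > 0" "C2 \<ge> 0" and L2: "L2-lipschitz_on (ball (F x) r2) G"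
    and D2: "\<And>y v. y \<in> ball (F x) r2 \<Longrightarrow> \<exists>d. has_dir_deriv G y v d"
    and E2: "\<And>y d. y \<in> ball (F x) r2 \<Longrightarrow> has_dir_deriv G y (y - F x) d \<Longrightarrow>
        norm (G y - G (F x) - d) \<le> C2 * (norm (y - F x))\<^sup>2"
    using G by (rule ssd_atE) blast
  have L0: "L1 \<ge> 0" "L2 \<ge> 0" using L1 L2 lipschitz_on_nonneg by auto
  \<comment> \<open>On this radius \<open>F\<close> stays inside the ball where \<open>G\<close> is
    controlled; the \<open>+ 1\<close> covers \<open>L1 = 0\<close>.\<close>
  define r where "r = min r1 (r2 / (L1 + 1))"
  have r: "r > 0" "r \<le> r1" unfolding r_def using r1 r2 L0 by auto
  have lipF: "norm (F y - F x) \<le> L1 * norm (y - x)" if "y \<in> ball x r" for y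
    using lipschitz_onD[OF L1, of y x] that r r1 by (auto simp: dist_norm)
  have Fball: "F y \<in> ball (F x) r2" if y: "y \<in> ball x r" for y
  proof -
    have "norm (F y - F x) \<le> L1 * norm (y - x)" by (rule lipF[OF y])
    also have "\<dots> \<le> (L1 + 1) * norm (y - x)" by (simp add: mult_right_mono)
    also have "\<dots> < r2"
    proof -
      have "norm (y - x) < r2 / (L1 + 1)" using y unfolding r_def
        by (simp add: dist_norm norm_minus_commute)
      then show ?thesis using L0 by (simp add: field_simps)
    qed
    finally show ?thesis by (simp add: dist_norm norm_minus_commute)
  qed
  have chain: "has_dir_deriv (\<lambda>x. G (F x)) y v d'"
    if "y \<in> ball x r" "has_dir_deriv F y v d" "has_dir_deriv G (F y) d d'" for y v d d'
  proof -
    have "F y \<in> ball (F x) r2" using Fball that(1) by blast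
    then obtain s where "s > 0" "ball (F y) s \<subseteq> ball (F x) r2"
      by (rule ball_in_ball_around)
    then show ?thesis
      using has_dir_deriv_compose[OF that(2,3) lipschitz_on_subset[OF L2]] by blast
  qed
  show ?thesis
  proof (rule ssd_atI[of r "L2 * C1 + C2 * L1\<^sup>2" "L2 * L1"])
    show "(L2 * L1)-lipschitz_on (ball x r) (\<lambda>x. G (F x))"
    proof (rule lipschitz_onI)
      fix y z assume yz: "y \<in> ball x r" "z \<in> ball x r"
      have "dist (G (F y)) (G (F z)) \<le> L2 * dist (F y) (F z)"
        using lipschitz_onD[OF L2] Fball yz by blast
      also have "dist (F y) (F z) \<le> L1 * dist y z"
        using lipschitz_onD[OF L1] yz r by auto
      finally show "dist (G (F y)) (G (F z)) \<le> L2 * L1 * dist y z"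
        using L0(2) by (simp add: mult_left_mono mult.assoc)
    qed (use L0 in auto)
    show "\<exists>d. has_dir_deriv (\<lambda>x. G (F x)) y v d" if "y \<in> ball x r" for y v
      using D1[of y v] D2[OF Fball[OF that]] chain[OF that] r that by fastforce
  next
    fix y d assume y: "y \<in> ball x r" and d: "has_dir_deriv (\<lambda>x. G (F x)) y (y - x) d"
    have y1: "y \<in> ball x r1" using y r by auto
    obtain d1 where d1: "has_dir_deriv F y (y - x) d1" using D1[OF y1] by blast
    obtain d2 where d2: "has_dir_deriv G (F y) d1 d2" using D2[OF Fball[OF y]] by blast
    \<comment> \<open>\<open>d2\<close> belongs to the linearised increment \<open>d1\<close>,
      \<open>d3\<close> to the true increment \<open>F y - F x\<close>. Their gap is at most
      \<open>L2\<close> times the remainder of \<open>F\<close>.\<close>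
    obtain d3 where d3: "has_dir_deriv G (F y) (F y - F x) d3" using D2[OF Fball[OF y]] by blast
    have dd: "d = d2" using has_dir_deriv_unique[OF d chain[OF y d1 d2]] .
    obtain s where s: "s > 0" "ball (F y) s \<subseteq> ball (F x) r2"
      using ball_in_ball_around[OF Fball[OF y]] .
    have "norm (d3 - d2) \<le> L2 * norm ((F y - F x) - d1)"
      using has_dir_deriv_lipschitz[OF d3 d2 lipschitz_on_subset[OF L2 s(2)] s(1)] .
    also have "\<dots> \<le> L2 * (C1 * (norm (y - x))\<^sup>2)"
      using E1[OF y1 d1] L0 by (intro mult_left_mono)
    finally have a: "norm (d3 - d2) \<le> L2 * C1 * (norm (y - x))\<^sup>2" by simp
    have "norm (G (F y) - G (F x) - d3) \<le> C2 * (norm (F y - F x))\<^sup>2"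
      by (rule E2[OF Fball[OF y] d3])
    also have "\<dots> \<le> C2 * (L1 * norm (y - x))\<^sup>2"
      using r2 lipF[OF y] by (intro mult_left_mono power_mono) auto
    finally have b: "norm (G (F y) - G (F x) - d3) \<le> C2 * L1\<^sup>2 * (norm (y - x))\<^sup>2"
      by (simp add: power_mult_distrib)
    have "norm (G (F y) - G (F x) - d) \<le> norm (G (F y) - G (F x) - d3) + norm (d3 - d2)"
      unfolding dd using norm_triangle_ineq[of "G (F y) - G (F x) - d3" "d3 - d2"] by simp
    with a b show "norm (G (F y) - G (F x) - d) \<le> (L2 * C1 + C2 * L1\<^sup>2) * (norm (y - x))\<^sup>2"
      by (simp add: algebra_simps)
  qed (use r r1 r2 L0 in auto)
qed

lemma ssd_at_Pair:
  fixes F :: "'a::real_normed_vector \<Rightarrow> 'b::real_normed_vector"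
    and G :: "'a \<Rightarrow> 'c::real_normed_vector"
  assumes F: "ssd_at F x" and G: "ssd_at G x"
  shows "ssd_at (\<lambda>x. (F x, G x)) x"
proof -
  obtain r1 L1 C1 where r1: "r1 > 0" "C1 \<ge> 0" and L1: "L1-lipschitz_on (ball x r1) F"
    and D1: "\<And>y v. y \<in> ball x r1 \<Longrightarrow> \<exists>d. has_dir_deriv F y v d"
    and E1: "\<And>y d. y \<in> ball x r1 \<Longrightarrow> has_dir_deriv F y (y - x) d \<Longrightarrow>
        norm (F y - F x - d) \<le> C1 * (norm (y - x))\<^sup>2"
    using F by (rule ssd_atE) blast
  obtain r2 L2 C2 where r2: "r2 > 0" "C2 \<ge> 0" and L2: "L2-lipschitz_on (ball x r2) G"
    and D2: "\<And>y v. y \<in> ball x r2 \<Longrightarrow> \<exists>d. has_dir_deriv G y v d"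
    and E2: "\<And>y d. y \<in> ball x r2 \<Longrightarrow> has_dir_deriv G y (y - x) d \<Longrightarrow>
        norm (G y - G x - d) \<le> C2 * (norm (y - x))\<^sup>2"
    using G by (rule ssd_atE) blast
  have L0: "L1 \<ge> 0" "L2 \<ge> 0" using L1 L2 lipschitz_on_nonneg by auto
  show ?thesis
  proof (rule ssd_atI[of "min r1 r2" "C1 + C2" "L1 + L2"])
    show "(L1 + L2)-lipschitz_on (ball x (min r1 r2)) (\<lambda>x. (F x, G x))"
    proof (rule lipschitz_onI)
      fix y z assume yz: "y \<in> ball x (min r1 r2)" "z \<in> ball x (min r1 r2)"
      have "dist (F y, G y) (F z, G z) \<le> dist (F y) (F z) + dist (G y) (G z)"
        unfolding dist_Pair_Pair by (simp add: sqrt_sum_squares_le_sum)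
      also have "\<dots> \<le> L1 * dist y z + L2 * dist y z"
        using lipschitz_onD[OF L1, of y z] lipschitz_onD[OF L2, of y z] yz by auto
      finally show "dist (F y, G y) (F z, G z) \<le> (L1 + L2) * dist y z" by (simp add: algebra_simps)
    qed (use L0 in auto)
    show "\<exists>d. has_dir_deriv (\<lambda>x. (F x, G x)) y v d" if "y \<in> ball x (min r1 r2)" for y v
      using D1[of y v] D2[of y v] that has_dir_deriv_Pair by fastforce
  next
    fix y d assume y: "y \<in> ball x (min r1 r2)"
      and d: "has_dir_deriv (\<lambda>x. (F x, G x)) y (y - x) d"
    have y12: "y \<in> ball x r1" "y \<in> ball x r2" using y by auto
    obtain d1 where d1: "has_dir_deriv F y (y - x) d1" using D1 y12 by blast
    obtain d2 where d2: "has_dir_deriv G y (y - x) d2" using D2 y12 by blast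
    have dd: "d = (d1, d2)" by (rule has_dir_deriv_unique[OF d has_dir_deriv_Pair[OF d1 d2]])
    have "norm ((F y, G y) - (F x, G x) - d) \<le> norm (F y - F x - d1) + norm (G y - G x - d2)"
      unfolding dd by (simp add: norm_Pair sqrt_sum_squares_le_sum)
    also have "\<dots> \<le> C1 * (norm (y - x))\<^sup>2 + C2 * (norm (y - x))\<^sup>2"
      using E1[OF y12(1) d1] E2[OF y12(2) d2] by (rule add_mono)
    finally show "norm ((F y, G y) - (F x, G x) - d) \<le> (C1 + C2) * (norm (y - x))\<^sup>2"
      by (simp add: algebra_simps)
  qed (use r1 r2 in auto)
qed

lemma ssd_at_C11:
  fixes f :: "'a::real_normed_vector \<Rightarrow> 'b::real_normed_vector"
  assumes r: "r > 0"
    and f': "\<And>y. y \<in> ball x r \<Longrightarrow> (f has_derivative f' y) (at y)"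
    and M: "\<And>y z v. y \<in> ball x r \<Longrightarrow> z \<in> ball x r \<Longrightarrow>
      norm (f' y v - f' z v) \<le> M * norm (y - z) * norm v"
  shows "ssd_at f x"
proof -
  have lin: "bounded_linear (f' y)" if "y \<in> ball x r" for y
    using f'[OF that] by (rule has_derivative_bounded_linear)
  have f'w: "(f has_derivative f' y) (at y within ball x r)" if "y \<in> ball x r" for y
    using f'[OF that] by (rule has_derivative_at_withinI)
  define M' where "M' = \<bar>M\<bar>"
  have M': "M' \<ge> 0" unfolding M'_def by simp
  have MM': "norm (f' y v - f' z v) \<le> M' * norm (y - z) * norm v"
    if "y \<in> ball x r" "z \<in> ball x r" for y z v
    using M[OF that, of v] unfolding M'_def
    by (meson abs_ge_self dual_order.trans mult_right_mono norm_ge_zero)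
  define L where "L = onorm (f' x) + M' * r"
  have L0: "L \<ge> 0" unfolding L_def using r M' lin[of x] by (simp add: onorm_pos_le)
  have on: "onorm (f' y) \<le> L" if y: "y \<in> ball x r" for y
  proof (rule onorm_bound[OF L0])
    fix v
    have "norm (f' y v) \<le> norm (f' x v) + norm (f' y v - f' x v)"
      by (metis norm_triangle_sub)
    also have "\<dots> \<le> onorm (f' x) * norm v + M' * norm (y - x) * norm v"
      using MM'[OF y, of x v] r onorm[OF lin[of x], of v] by (intro add_mono) auto
    also have "\<dots> \<le> onorm (f' x) * norm v + M' * r * norm v"
      using y M' by (intro add_mono mult_right_mono mult_left_mono)
        (auto simp: dist_norm norm_minus_commute)
    finally show "norm (f' y v) \<le> L * norm v" unfolding L_def by (simp add: algebra_simps)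
  qed
  have dd: "has_dir_deriv f y v (f' y v)" if "y \<in> ball x r" for y v
    using has_derivative_imp_has_dir_deriv[OF f'[OF that]] by simp
  show ?thesis
  proof (rule ssd_atI[of r M' L])
    show "L-lipschitz_on (ball x r) f"
      using differentiable_bound[OF convex_ball f'w on] L0
      by (intro lipschitz_onI) (auto simp: dist_norm)
  next
    fix y d assume y: "y \<in> ball x r" and d: "has_dir_deriv f y (y - x) d"
    have seg: "closed_segment x y \<subseteq> ball x r"
      using y r by (simp add: closed_segment_subset)
    have "norm (f y - f x - f' y (y - x)) \<le> norm (y - x) * (M' * norm (y - x))"
    \<comment> \<open>The linearisation is centred at the endpoint \<open>y\<close>, as
      \<open>ssd_at\<close> requires, so the derivative is compared with \<open>f' y\<close> along
      the segment.\<close>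
    proof (rule differentiable_bound_linearization[where S = "closed_segment x y" and f' = f'])
      show "x + t *\<^sub>R (y - x) \<in> closed_segment x y" if "t \<in> {0..1}" for t
        using that by (auto simp: closed_segment_def algebra_simps intro!: exI[of _ t])
      show "(f has_derivative f' z) (at z within closed_segment x y)" if "z \<in> closed_segment x y" for z
        using f' seg that has_derivative_at_withinI by blast
      show "onorm (f' z - f' y) \<le> M' * norm (y - x)" if z: "z \<in> closed_segment x y" for z
      proof (rule onorm_bound)
        fix v
        have "norm (f' z v - f' y v) \<le> M' * norm (z - y) * norm v"
          using MM' seg z y by blast
        also have "\<dots> \<le> M' * norm (y - x) * norm v"
          using segment_bound(2)[OF z] M' by (intro mult_right_mono mult_left_mono)
            (auto simp: norm_minus_commute)
        finally show "norm ((f' z - f' y) v) \<le> M' * norm (y - x) * norm v" by simp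
      qed (use M' in auto)
    qed auto
    then show "norm (f y - f x - d) \<le> M' * (norm (y - x))\<^sup>2"
      using has_dir_deriv_unique[OF d dd[OF y]] by (simp add: power2_eq_square ac_simps)
  qed (use r M' dd in auto)
qed

section \<open>Calculus rules for semismooth functions\<close>

lemma ssd_at_bounded_linear:
  assumes "bounded_linear f" shows "ssd_at f x"
  by (rule ssd_at_C11[of 1 x f "\<lambda>_. f" 0])
    (use bounded_linear_imp_has_derivative[OF assms] in auto)

lemma ssd_at_const: "ssd_at (\<lambda>_. c) x"
  by (rule ssd_at_C11[of 1 x _ "\<lambda>_ _. 0" 0]) auto

lemma ssd_at_bounded_bilinear:
  assumes "bounded_bilinear b" shows "ssd_at (\<lambda>z. b (fst z) (snd z)) z0"
proof -
  interpret bounded_bilinear b by fact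
  obtain K where K: "\<And>a c. norm (b a c) \<le> norm a * norm c * K" using bounded by blast
  show ?thesis
  proof (rule ssd_at_C11[of 1 z0 _ "\<lambda>z v. b (fst z) (snd v) + b (fst v) (snd z)" "2 * \<bar>K\<bar>"])
    show "((\<lambda>z. b (fst z) (snd z)) has_derivative (\<lambda>v. b (fst z) (snd v) + b (fst v) (snd z))) (at z)" for z
      by (intro FDERIV has_derivative_fst has_derivative_snd has_derivative_ident)
  next
    fix y z v
    have n: "norm (b a c) \<le> norm a * norm c * \<bar>K\<bar>" for a c
      using K[of a c] by (meson abs_ge_self dual_order.trans mult_left_mono mult_nonneg_nonneg norm_ge_zero)
    have n1: "norm (fst w) \<le> norm w" and n2: "norm (snd w) \<le> norm w" for w :: "'a \<times> 'b"
      by (metis norm_fst_le prod.collapse, metis norm_snd_le prod.collapse)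
    have "b (fst y) (snd v) + b (fst v) (snd y) - (b (fst z) (snd v) + b (fst v) (snd z))
        = b (fst (y - z)) (snd v) + b (fst v) (snd (y - z))"
      by (simp add: diff_left diff_right)
    also have "norm \<dots> \<le> norm (fst (y - z)) * norm (snd v) * \<bar>K\<bar> + norm (fst v) * norm (snd (y - z)) * \<bar>K\<bar>"
      using n norm_triangle_mono by blast
    also have "\<dots> \<le> norm (y - z) * norm v * \<bar>K\<bar> + norm v * norm (y - z) * \<bar>K\<bar>"
      using n1[of v] n1[of "y - z"] n2[of v] n2[of "y - z"] by (intro add_mono mult_right_mono mult_mono) auto
    finally show "norm (b (fst y) (snd v) + b (fst v) (snd y) - (b (fst z) (snd v) + b (fst v) (snd z)))
        \<le> 2 * \<bar>K\<bar> * norm (y - z) * norm v"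
      by (simp add: algebra_simps)
  qed auto
qed

lemma ssd_at_ident: "ssd_at (\<lambda>x. x) x"
  by (rule ssd_at_bounded_linear[OF bounded_linear_ident])

lemma ssd_at_linear_compose:
  "bounded_linear f \<Longrightarrow> ssd_at F x \<Longrightarrow> ssd_at (\<lambda>x. f (F x)) x"
  by (rule ssd_at_compose[OF ssd_at_bounded_linear])

lemma ssd_at_bilinear_compose:
  assumes "bounded_bilinear b" "ssd_at F x" "ssd_at G x"
  shows "ssd_at (\<lambda>x. b (F x) (G x)) x"
  using ssd_at_compose[where F = "\<lambda>x. (F x, G x)",
      OF ssd_at_bounded_bilinear[OF assms(1)] ssd_at_Pair[OF assms(2,3)]]
  by simp

lemma ssd_at_add:
  assumes "ssd_at F x" "ssd_at G x"
  shows "ssd_at (\<lambda>x. F x + G x) x"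
  using ssd_at_linear_compose[OF bounded_linear_add[OF bounded_linear_fst bounded_linear_snd]
      ssd_at_Pair[OF assms]] by simp

lemma ssd_at_diff:
  assumes "ssd_at F x" "ssd_at G x"
  shows "ssd_at (\<lambda>x. F x - G x) x"
  using ssd_at_linear_compose[OF bounded_linear_sub[OF bounded_linear_fst bounded_linear_snd]
      ssd_at_Pair[OF assms]] by simp

lemmas ssd_at_scaleR = ssd_at_bilinear_compose[OF bounded_bilinear_scaleR]
lemmas ssd_at_mult = ssd_at_bilinear_compose[OF bounded_bilinear_mult]
lemmas ssd_at_inner = ssd_at_bilinear_compose[OF bounded_bilinear_inner]
lemmas ssd_at_fst = ssd_at_linear_compose[OF bounded_linear_fst]
lemmas ssd_at_snd = ssd_at_linear_compose[OF bounded_linear_snd]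

lemma ssd_at_power2:
  fixes F :: "'a::real_normed_vector \<Rightarrow> 'b::real_normed_algebra_1"
  shows "ssd_at F x \<Longrightarrow> ssd_at (\<lambda>x. (F x)\<^sup>2) x"
  unfolding power2_eq_square by (intro ssd_at_mult)

text \<open>Continuity of \<open>f''\<close> at the one point \<open>x\<close> bounds it on a ball,
  and the mean value inequality then makes \<open>f'\<close> Lipschitz there.\<close>

lemma ssd_at_real_C2:
  fixes f :: "real \<Rightarrow> real"
  assumes r: "r > 0"
    and f': "\<And>y. y \<in> ball x r \<Longrightarrow> (f has_real_derivative f' y) (at y)"
    and f'': "\<And>y. y \<in> ball x r \<Longrightarrow> (f' has_real_derivative f'' y) (at y)"
    and cont: "isCont f'' x"
  shows "ssd_at f x"
proof -
  have "\<forall>\<^sub>F y in nhds x. f'' y \<in> ball (f'' x) 1"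
    using cont unfolding isCont_def tendsto_at_iff_tendsto_nhds
    by (rule topological_tendstoD) simp_all
  then obtain s where s: "s > 0" "\<And>y. y \<in> ball x s \<Longrightarrow> f'' y \<in> ball (f'' x) 1"
    unfolding eventually_nhds_metric by (metis mem_ball dist_commute)
  define M where "M = \<bar>f'' x\<bar> + 1"
  have M: "norm (f'' y) \<le> M" if "y \<in> ball x s" for y
    using s(2)[OF that] unfolding M_def by (simp add: dist_real_def)
  show ?thesis
  proof (rule ssd_at_C11[of "min r s" x f "\<lambda>y v. v * f' y" M])
    show "min r s > 0" using r s by simp
    show "(f has_derivative (\<lambda>v. v * f' y)) (at y)" if "y \<in> ball x (min r s)" for y
      using f'[of y] that by (simp add: has_field_derivative_def mult_commute_abs)
    fix y z v assume yz: "y \<in> ball x (min r s)" "z \<in> ball x (min r s)"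
    have "norm (f' y - f' z) \<le> M * norm (y - z)"
    proof (rule field_differentiable_bound[of "ball x (min r s)" f' f''])
      show "(f' has_field_derivative f'' w) (at w within ball x (min r s))"
        if "w \<in> ball x (min r s)" for w
        using f''[of w] that by (simp add: has_field_derivative_at_within)
    qed (use M yz in auto)
    then show "norm (v * f' y - v * f' z) \<le> M * norm (y - z) * norm v"
      by (simp add: right_diff_distrib[symmetric] abs_mult mult.commute mult_left_mono)
  qed
qed

lemma ssd_at_exp:
  assumes "ssd_at F x" shows "ssd_at (\<lambda>x. exp (F x :: real)) x"
  by (rule ssd_at_compose[OF _ assms], rule ssd_at_real_C2[of 1 _ _ exp exp])
    (auto intro!: DERIV_exp)

lemma ssd_at_inverse:
  assumes F: "ssd_at F x" and nz: "F x \<noteq> (0::real)"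
  shows "ssd_at (\<lambda>x. inverse (F x)) x"
proof (rule ssd_at_compose[OF _ F])
  show "ssd_at inverse (F x)"
  proof (rule ssd_at_real_C2[of "\<bar>F x\<bar>" _ _ "\<lambda>y. - (inverse y)\<^sup>2" "\<lambda>y. 2 * (inverse y) ^ 3"])
    have ne: "y \<noteq> 0" if "y \<in> ball (F x) \<bar>F x\<bar>" for y
      using that by (auto simp: dist_real_def)
    show "(inverse has_real_derivative - (inverse y)\<^sup>2) (at y)" if "y \<in> ball (F x) \<bar>F x\<bar>" for y
      using DERIV_inverse[OF ne[OF that]] by (simp add: numeral_2_eq_2)
    show "((\<lambda>y. - (inverse y)\<^sup>2) has_real_derivative 2 * (inverse y) ^ 3) (at y)"
      if "y \<in> ball (F x) \<bar>F x\<bar>" for y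
      using ne[OF that] by (auto intro!: derivative_eq_intros simp: power2_eq_square power3_eq_cube)
    show "isCont (\<lambda>y. 2 * (inverse y) ^ 3) (F x)"
      using nz by (intro continuous_intros)
  qed (use nz in auto)
qed

lemma ssd_at_divide:
  assumes "ssd_at F x" "ssd_at G x" "G x \<noteq> (0::real)"
  shows "ssd_at (\<lambda>x. F x / G x) x"
  unfolding divide_inverse using assms by (intro ssd_at_mult ssd_at_inverse)

lemma ssd_at_sqrt:
  assumes F: "ssd_at F x" and pos: "F x > 0"
  shows "ssd_at (\<lambda>x. sqrt (F x)) x"
proof (rule ssd_at_compose[OF _ F])
  show "ssd_at sqrt (F x)"
  proof (rule ssd_at_real_C2[of "F x" _ _ "\<lambda>y. inverse (sqrt y) / 2" "\<lambda>y. - ((inverse (sqrt y)) ^ 3) / 4"])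
    have pos': "y > 0" if "y \<in> ball (F x) (F x)" for y
      using that by (auto simp: dist_real_def)
    show "(sqrt has_real_derivative inverse (sqrt y) / 2) (at y)" if "y \<in> ball (F x) (F x)" for y
      using DERIV_real_sqrt[OF pos'[OF that]] .
    show "((\<lambda>y. inverse (sqrt y) / 2) has_real_derivative - ((inverse (sqrt y)) ^ 3) / 4) (at y)"
      if "y \<in> ball (F x) (F x)" for y
      using pos'[OF that] by (auto intro!: derivative_eq_intros simp: power2_eq_square power3_eq_cube)
    show "isCont (\<lambda>y. - ((inverse (sqrt y)) ^ 3) / 4) (F x)"
      using pos by (intro continuous_intros) auto
  qed (use pos in auto)
qed

section \<open>Positively homogeneous functions, norms and maxima\<close>

text \<open>Along its own direction the quotient is constant, because
  \<open>y + t *\<^sub>R y\<close> is \<open>(1 + t) *\<^sub>R y\<close>.\<close>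

lemma has_dir_deriv_homogeneous:
  assumes "\<And>t y. t > 0 \<Longrightarrow> F (t *\<^sub>R y) = t *\<^sub>R F y"
  shows "has_dir_deriv F y y (F y)"
proof -
  have "\<forall>\<^sub>F t in at_right 0. F y = (1 / t) *\<^sub>R (F (y + t *\<^sub>R y) - F y)"
    using eventually_right_pos
  proof eventually_elim
    case (elim t)
    have "F (y + t *\<^sub>R y) = (1 + t) *\<^sub>R F y"
      using assms[of "1 + t" y] elim by (simp add: algebra_simps)
    then show ?case using elim by (simp add: algebra_simps)
  qed
  then show ?thesis
    unfolding has_dir_deriv_def by (rule Lim_transform_eventually[OF tendsto_const])
qed

text \<open>Euler's identity makes the second-order remainder at the apex vanish identically.\<close>

lemma ssd_at_homogeneous:
  fixes F :: "'a::real_normed_vector \<Rightarrow> 'b::real_normed_vector"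
  assumes hom: "\<And>t y. t > 0 \<Longrightarrow> F (t *\<^sub>R y) = t *\<^sub>R F y"
    and L: "L-lipschitz_on UNIV F"
    and off: "\<And>y. y \<noteq> 0 \<Longrightarrow> ssd_at F y"
  shows "ssd_at F x"
proof (cases "x = 0")
  case False
  then show ?thesis by (rule off)
next
  case x: True
  have F0: "F 0 = 0"
  proof -
    have "F 0 = 2 *\<^sub>R F 0" using hom[of 2 0] by simp
    then show ?thesis by (simp add: scaleR_2)
  qed
  show ?thesis unfolding x
  proof (rule ssd_atI[of 1 0 L])
    show "L-lipschitz_on (ball 0 1) F" using L by (rule lipschitz_on_subset) simp
    show "\<exists>d. has_dir_deriv F y v d" for y v
    proof (cases "y = 0")
      case True
      have "\<forall>\<^sub>F t in at_right 0. F v = (1 / t) *\<^sub>R (F (0 + t *\<^sub>R v) - F 0)"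
        using eventually_right_pos by eventually_elim (simp add: hom F0)
      then have "has_dir_deriv F 0 v (F v)"
        unfolding has_dir_deriv_def by (rule Lim_transform_eventually[OF tendsto_const])
      with True show ?thesis by blast
    qed (use off ssd_at_dir_deriv_ex in blast)
    show "norm (F y - F 0 - d) \<le> 0 * (norm (y - 0))\<^sup>2" if "has_dir_deriv F y (y - 0) d" for y d
      using has_dir_deriv_unique[of F y y d "F y"] that has_dir_deriv_homogeneous[OF hom] F0 by simp
  qed auto
qed

lemma ssd_at_norm_ident:
  fixes x :: "'a::real_inner"
  shows "ssd_at norm x"
proof (rule ssd_at_homogeneous[of norm 1])
  show "1-lipschitz_on UNIV (norm :: 'a \<Rightarrow> real)"
    by (intro lipschitz_onI) (auto simp: dist_norm norm_triangle_ineq3)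
  show "ssd_at norm y" if "y \<noteq> 0" for y :: 'a
    unfolding norm_eq_sqrt_inner using that
    by (intro ssd_at_sqrt ssd_at_inner ssd_at_ident) auto
qed auto

lemma ssd_at_norm:
  fixes F :: "'a::real_normed_vector \<Rightarrow> 'b::real_inner"
  shows "ssd_at F x \<Longrightarrow> ssd_at (\<lambda>x. norm (F x)) x"
  by (rule ssd_at_compose[OF ssd_at_norm_ident])

lemma ssd_at_max:
  fixes F G :: "'a::real_normed_vector \<Rightarrow> real"
  assumes "ssd_at F x" "ssd_at G x"
  shows "ssd_at (\<lambda>x. max (F x) (G x)) x"
proof -
  have "(\<lambda>x. max (F x) (G x)) = (\<lambda>x. (1/2) *\<^sub>R (F x + G x + norm (F x - G x)))"
    by (auto simp: max_def fun_eq_iff)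
  then show ?thesis using assms
    by (simp only:) (intro ssd_at_scaleR ssd_at_add ssd_at_norm ssd_at_diff ssd_at_const)
qed

lemma ssd_at_min:
  fixes F G :: "'a::real_normed_vector \<Rightarrow> real"
  assumes "ssd_at F x" "ssd_at G x"
  shows "ssd_at (\<lambda>x. min (F x) (G x)) x"
proof -
  have "(\<lambda>x. min (F x) (G x)) = (\<lambda>x. F x + G x - max (F x) (G x))"
    by (auto simp: max_def min_def fun_eq_iff)
  then show ?thesis using assms
    by (simp only:) (intro ssd_at_add ssd_at_diff ssd_at_max)
qed

section \<open>From directional derivatives to the Clarke Jacobian\<close>

text \<open>\<open>G\<close> extends \<open>F\<close> off the subspace \<open>S\<close>. Derivatives
  of \<open>F\<close> within \<open>S\<close> are directional derivatives of \<open>G\<close> along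
  \<open>S\<close>, so \<open>E\<close> applies at differentiability points; the bound survives
  limits and then convex combinations.\<close>

lemma clarke_jac_remainder_le:
  fixes F G :: "'a::euclidean_space \<Rightarrow> 'b::euclidean_space"
  assumes S: "subspace S" and FG: "\<And>y. y \<in> S \<Longrightarrow> F y = G y" and x: "x \<in> S"
    and r: "r > 0" and L: "L-lipschitz_on (ball x r) G"
    and E: "\<And>y d. y \<in> ball x r \<Longrightarrow> has_dir_deriv G y (y - x) d \<Longrightarrow>
        norm (G y - G x - d) \<le> C * (norm (y - x))\<^sup>2"
    and h: "h \<in> S" "norm h < r" and V: "V \<in> clarke_jac S F (x + h)"
  shows "norm (F (x + h) - F x - V h) \<le> C * (norm h)\<^sup>2"
proof -
  have L0: "L \<ge> 0" using L lipschitz_on_nonneg by auto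
  have xh: "x + h \<in> S" using subspace_add[OF S x h(1)] .
  have xhb: "x + h \<in> ball x r" using h by (simp add: dist_norm)
  have B: "norm (F (x + h) - F x - W h) \<le> C * (norm h)\<^sup>2" if W: "W \<in> B_jac S F (x + h)" for W
  proof -
    from W obtain xs D where xsS: "\<And>k. xs k \<in> S"
      and D: "\<And>k. (F has_derivative D k) (at (xs k) within S)"
      and xs: "xs \<longlonglongrightarrow> x + h" and DW: "(\<lambda>k. D k h) \<longlonglongrightarrow> W h"
      unfolding B_jac_def using h(1) by blast
    have DG: "has_dir_deriv G (xs k) v (D k v)" if v: "v \<in> S" for k v
    proof -
      have ray: "xs k + t *\<^sub>R v \<in> S" for t
        using S xsS v by (simp add: subspace_add subspace_scale)
      have "has_dir_deriv F (xs k) v (D k v)"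
        by (rule has_derivative_imp_has_dir_deriv[OF D ray])
      then show ?thesis unfolding has_dir_deriv_def using FG[OF ray] FG[OF xsS] by simp
    qed
    have inb: "\<forall>\<^sub>F k in sequentially. xs k \<in> ball x r"
      using topological_tendstoD[OF xs open_ball xhb] .
    have bd: "norm (D k v) \<le> L * norm v" if "xs k \<in> ball x r" "v \<in> S" for k v
    proof -
      from that(1) obtain s where "s > 0" "ball (xs k) s \<subseteq> ball x r"
        by (rule ball_in_ball_around)
      then show ?thesis
        using has_dir_deriv_lipschitz_bound[OF DG[OF that(2)] lipschitz_on_subset[OF L]] by blast
    qed
    \<comment> \<open>The estimate \<open>E\<close> holds along \<open>xs k - x\<close>. Exchanging
      this direction for \<open>h\<close> costs a Lipschitz term that vanishes in the limit.\<close>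
    have ev: "\<forall>\<^sub>F k in sequentially. norm (G (xs k) - G x - D k h)
        \<le> C * (norm (xs k - x))\<^sup>2 + L * norm (xs k - (x + h))"
      using inb
    proof eventually_elim
      case (elim k)
      have lin: "linear (D k)" using has_derivative_bounded_linear[OF D] bounded_linear.linear by blast
      have v: "xs k - x \<in> S" "xs k - (x + h) \<in> S" using S xsS x xh by (auto intro: subspace_diff)
      have "D k (xs k - x) - D k h = D k (xs k - (x + h))"
        using lin by (simp add: linear_diff linear_add)
      then have "norm (D k (xs k - x) - D k h) \<le> L * norm (xs k - (x + h))"
        using bd[OF elim v(2)] by simp
      moreover have "norm (G (xs k) - G x - D k (xs k - x)) \<le> C * (norm (xs k - x))\<^sup>2"
        by (rule E[OF elim DG[OF v(1)]])
      ultimately show ?case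
        using norm_triangle_ineq[of "G (xs k) - G x - D k (xs k - x)" "D k (xs k - x) - D k h"] by simp
    qed
    have contG: "isCont G (x + h)"
      using L xhb by (metis continuous_on_interior interior_ball lipschitz_on_continuous_on)
    have lim1: "(\<lambda>k. norm (G (xs k) - G x - D k h)) \<longlonglongrightarrow> norm (G (x + h) - G x - W h)"
      by (intro tendsto_intros isCont_tendsto_compose[OF contG] xs DW)
    have "(\<lambda>k. C * (norm (xs k - x))\<^sup>2 + L * norm (xs k - (x + h)))
        \<longlonglongrightarrow> C * (norm ((x + h) - x))\<^sup>2 + L * norm ((x + h) - (x + h))"
      by (intro tendsto_intros xs)
    then have "norm (G (x + h) - G x - W h) \<le> C * (norm ((x + h) - x))\<^sup>2 + L * norm ((x + h) - (x + h))"
      using lim1 ev by (rule tendsto_le[OF sequentially_bot])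
    then show ?thesis using FG[OF x] FG[OF xh] by simp
  qed
  from V obtain n :: nat and c Vs where c: "\<And>i. i < n \<Longrightarrow> c i \<ge> (0::real)"
    and Vs: "\<And>i. i < n \<Longrightarrow> Vs i \<in> B_jac S F (x + h)"
    and c1: "(\<Sum>i<n. c i) = 1" and Vh: "V h = (\<Sum>i<n. c i *\<^sub>R Vs i h)"
    unfolding clarke_jac_def using h(1) by blast
  let ?z = "F (x + h) - F x"
  have "?z = (\<Sum>i<n. c i *\<^sub>R ?z)"
    by (simp add: scaleR_left.sum[symmetric] c1)
  then have "?z - V h = (\<Sum>i<n. c i *\<^sub>R ?z) - (\<Sum>i<n. c i *\<^sub>R Vs i h)"
    using Vh by metis
  also have "\<dots> = (\<Sum>i<n. c i *\<^sub>R (?z - Vs i h))"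
    by (simp only: scaleR_diff_right sum_subtractf)
  finally have eq: "?z - V h = (\<Sum>i<n. c i *\<^sub>R (?z - Vs i h))" .
  have "norm (?z - V h) \<le> (\<Sum>i<n. norm (c i *\<^sub>R (?z - Vs i h)))"
    unfolding eq by (rule norm_sum)
  also have "\<dots> \<le> (\<Sum>i<n. c i * (C * (norm h)\<^sup>2))"
    using c B[OF Vs] by (intro sum_mono) (auto intro!: mult_left_mono)
  also have "\<dots> = C * (norm h)\<^sup>2" by (simp add: sum_distrib_right[symmetric] c1)
  finally show ?thesis .
qed

lemma ssd_at_imp_strongly_semismooth_at:
  fixes F G :: "'a::euclidean_space \<Rightarrow> 'b::euclidean_space"
  assumes S: "subspace S" and FG: "\<And>y. y \<in> S \<Longrightarrow> F y = G y" and x: "x \<in> S"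
    and G: "ssd_at G x"
  shows "strongly_semismooth_at S F x"
proof -
  obtain r L C where r: "r > 0" and L: "L-lipschitz_on (ball x r) G"
    and D: "\<And>y v. y \<in> ball x r \<Longrightarrow> \<exists>d. has_dir_deriv G y v d"
    and E: "\<And>y d. y \<in> ball x r \<Longrightarrow> has_dir_deriv G y (y - x) d \<Longrightarrow>
        norm (G y - G x - d) \<le> C * (norm (y - x))\<^sup>2"
    using G by (rule ssd_atE) blast
  have "\<exists>d. ((\<lambda>t. (1 / t) *\<^sub>R (F (x + t *\<^sub>R h) - F x)) \<longlongrightarrow> d) (at_right 0)" if "h \<in> S" for h
  proof -
    have "x + t *\<^sub>R h \<in> S" for t using S x that by (simp add: subspace_add subspace_scale)
    then show ?thesis
      using ssd_at_dir_deriv_ex[OF G, of h] FG[OF x] FG unfolding has_dir_deriv_def by simp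
  qed
  moreover have "\<exists>r>0. \<exists>L. \<forall>y\<in>S \<inter> ball x r. \<forall>z\<in>S \<inter> ball x r. dist (F y) (F z) \<le> L * dist y z"
    using lipschitz_onD[OF L] r FG by (intro exI[of _ r] conjI exI[of _ L]) auto
  moreover have "\<exists>C \<delta>. \<delta> > 0 \<and> (\<forall>h\<in>S. 0 < norm h \<and> norm h < \<delta> \<longrightarrow>
        (\<forall>V\<in>clarke_jac S F (x + h). norm (F (x + h) - F x - V h) \<le> C * (norm h)\<^sup>2))"
    using clarke_jac_remainder_le[OF S FG x r L E] r by blast
  ultimately show ?thesis unfolding strongly_semismooth_at_def by blast
qed

section \<open>Implicit functions and soft thresholding\<close>

lemma strongly_mono_root:
  fixes f :: "real \<Rightarrow> real"
  assumes cont: "continuous_on UNIV f" and mu: "\<mu> > 0"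
    and mono: "\<And>a b. a \<le> b \<Longrightarrow> \<mu> * (b - a) \<le> f b - f a"
  shows "\<exists>x. f x = 0"
proof -
  \<comment> \<open>At distance \<open>M\<close> from \<open>0\<close> the slope
    \<open>\<mu>\<close> has made up for the value \<open>f 0\<close>, so \<open>f\<close> changes
    sign between \<open>- M\<close> and \<open>M\<close>.\<close>
  define M where "M = \<bar>f 0\<bar> / \<mu>"
  have M: "M \<ge> 0" "\<mu> * M = \<bar>f 0\<bar>" unfolding M_def using mu by auto
  have "f (- M) \<le> 0" using mono[of "- M" 0] M by simp
  moreover have "f M \<ge> 0" using mono[of 0 M] M by simp
  ultimately show ?thesis
    using IVT'[of f "- M" 0 M] M continuous_on_subset[OF cont] by auto
qed

text \<open>Strong monotonicity passes to the directional derivatives of \<open>H\<close> in their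
  first component. The derivative equation thus has a root \<open>q\<close>, which is the derivative
  of \<open>p\<close>, and the remainder of \<open>p\<close> is controlled by that of
  \<open>H\<close> divided by \<open>\<mu>\<close>.\<close>

lemma ssd_at_implicit:
  fixes H :: "real \<times> 'a::real_normed_vector \<Rightarrow> real" and p :: "'a \<Rightarrow> real"
  assumes H: "\<And>z. ssd_at H z" and mu: "\<mu> > 0"
    and mono: "\<And>a b u. a \<le> b \<Longrightarrow> \<mu> * (b - a) \<le> H (b, u) - H (a, u)"
    and root: "\<And>u. H (p u, u) = 0"
  shows "ssd_at p x"
proof -
  have mono_abs: "\<mu> * \<bar>a - b\<bar> \<le> \<bar>H (a, u) - H (b, u)\<bar>" for a b u
    using mono[of a b u] mono[of b a u] mu by (cases "a \<le> b") auto
  have dmono: "\<mu> * (q' - q) \<le> d' - d"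
    if "has_dir_deriv H z (q, v) d" "has_dir_deriv H z (q', v) d'" "q \<le> q'" for z q q' v d d'
  proof -
    have "((\<lambda>t. (1 / t) *\<^sub>R (H (z + t *\<^sub>R (q', v)) - H z) - (1 / t) *\<^sub>R (H (z + t *\<^sub>R (q, v)) - H z))
        \<longlongrightarrow> d' - d) (at_right 0)"
      using that unfolding has_dir_deriv_def by (intro tendsto_diff)
    moreover have "\<forall>\<^sub>F t in at_right 0. \<mu> * (q' - q) \<le>
        (1 / t) *\<^sub>R (H (z + t *\<^sub>R (q', v)) - H z) - (1 / t) *\<^sub>R (H (z + t *\<^sub>R (q, v)) - H z)"
      using eventually_right_pos
    proof eventually_elim
      case (elim t)
      have "\<mu> * (t * (q' - q)) \<le> H (z + t *\<^sub>R (q', v)) - H (z + t *\<^sub>R (q, v))"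
        using mono[of "fst z + t * q" "fst z + t * q'" "snd z + t *\<^sub>R v"] elim that(3)
        by (simp add: plus_prod_def right_diff_distrib mult_left_mono)
      then show ?case using elim by (simp add: field_simps)
    qed
    ultimately show ?thesis by (rule tendsto_lowerbound) simp
  qed
  have dmono_abs: "\<mu> * \<bar>q - q'\<bar> \<le> \<bar>d - d'\<bar>"
    if "has_dir_deriv H z (q, v) d" "has_dir_deriv H z (q', v) d'" for z q q' v d d'
    using dmono[OF that] dmono[OF that(2,1)] mu by (cases "q \<le> q'") auto
  have dp: "\<exists>q. has_dir_deriv p u v q \<and> has_dir_deriv H (p u, u) (q, v) 0" for u v
  proof -
    let ?z = "(p u, u)"
    obtain r L C where r: "r > 0" and L: "L-lipschitz_on (ball ?z r) H"
      using H[of ?z] by (rule ssd_atE)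
    have "\<forall>q. \<exists>d. has_dir_deriv H ?z (q, v) d" using ssd_at_dir_deriv_ex[OF H] by blast
    then obtain f where f: "\<And>q. has_dir_deriv H ?z (q, v) (f q)" by metis
    have "L-lipschitz_on UNIV f"
    proof (rule lipschitz_onI)
      show "dist (f q) (f q') \<le> L * dist q q'" for q q'
        using has_dir_deriv_lipschitz[OF f f L r, of q q'] by (simp add: dist_norm)
    qed (use L lipschitz_on_nonneg in auto)
    then have "continuous_on UNIV f" by (rule lipschitz_on_continuous_on)
    \<comment> \<open>Along \<open>(q, v)\<close> the quotient of \<open>H\<close> tends to
      \<open>0\<close>; by strong monotonicity it dominates \<open>\<mu>\<close> times the distance
      between \<open>q\<close> and the quotient of \<open>p\<close>.\<close>
    then obtain q where q: "f q = 0" using strongly_mono_root[of f \<mu>] mu dmono[OF f f] by blast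
    have Hq: "has_dir_deriv H ?z (q, v) 0" using f[of q] q by simp
    have "\<forall>\<^sub>F t in at_right 0. norm ((1 / t) *\<^sub>R (p (u + t *\<^sub>R v) - p u) - q)
        \<le> (1 / \<mu>) * norm ((1 / t) *\<^sub>R (H (?z + t *\<^sub>R (q, v)) - H ?z))"
      using eventually_right_pos
    proof eventually_elim
      case (elim t)
      have "\<mu> * \<bar>p (u + t *\<^sub>R v) - (p u + t * q)\<bar> \<le> \<bar>H (?z + t *\<^sub>R (q, v)) - H ?z\<bar>"
        using mono_abs[of "p (u + t *\<^sub>R v)" "p u + t * q" "u + t *\<^sub>R v"] by (simp add: root)
      moreover have "(1 / t) *\<^sub>R (p (u + t *\<^sub>R v) - p u) - q = (p (u + t *\<^sub>R v) - (p u + t * q)) / t"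
        using elim by (simp add: field_simps)
      ultimately show ?case using elim mu by (simp add: field_simps)
    qed
    then have "((\<lambda>t. (1 / t) *\<^sub>R (p (u + t *\<^sub>R v) - p u) - q) \<longlongrightarrow> 0) (at_right 0)"
    proof (rule Lim_null_comparison)
      have "((\<lambda>t. (1 / \<mu>) * norm ((1 / t) *\<^sub>R (H (?z + t *\<^sub>R (q, v)) - H ?z))) \<longlongrightarrow> (1 / \<mu>) * norm (0::real))
        (at_right 0)"
      using Hq unfolding has_dir_deriv_def by (intro tendsto_intros)
      then show "((\<lambda>t. (1 / \<mu>) * norm ((1 / t) *\<^sub>R (H (?z + t *\<^sub>R (q, v)) - H ?z))) \<longlongrightarrow> 0) (at_right 0)"
        by simp
    qed
    then have "has_dir_deriv p u v q" unfolding has_dir_deriv_def by (rule LIM_zero_cancel)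
    with Hq show ?thesis by blast
  qed
  let ?zx = "(p x, x)"
  from H[of ?zx] obtain r L C where r: "r > 0" and C: "C \<ge> 0" and L: "L-lipschitz_on (ball ?zx r) H"
    and E: "\<And>y d. y \<in> ball ?zx r \<Longrightarrow> has_dir_deriv H y (y - ?zx) d \<Longrightarrow>
        norm (H y - H ?zx - d) \<le> C * (norm (y - ?zx))\<^sup>2"
    unfolding ssd_at_def by metis
  have L0: "L \<ge> 0" using L lipschitz_on_nonneg by auto
  have lip: "\<bar>p u - p u'\<bar> \<le> L / \<mu> * norm (u - u')"
    if "(p u, u) \<in> ball ?zx r" "(p u, u') \<in> ball ?zx r" for u u'
  proof -
    have "\<mu> * \<bar>p u - p u'\<bar> \<le> \<bar>H (p u, u') - H (p u, u)\<bar>"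
      using mono_abs[of "p u" "p u'" u'] by (simp add: root)
    also have "\<dots> \<le> L * norm (u - u')"
      using lipschitz_onD[OF L that(2,1)] by (simp add: dist_Pair_Pair dist_norm norm_minus_commute)
    finally show ?thesis using mu by (simp add: field_simps)
  qed
  \<comment> \<open>Half of \<open>r\<close> is reserved for each component; the second bound makes
    the Lipschitz estimate keep \<open>p u\<close> within \<open>r / 2\<close> of
    \<open>p x\<close>.\<close>
  define s where "s = min (r / 2) (r * \<mu> / (2 * (L + 1)))"
  have s: "s > 0" "s \<le> r / 2" unfolding s_def using r mu L0 by (simp, simp only: min.cobounded1)
  have px: "\<bar>p u - p x\<bar> < r / 2" if u: "u \<in> ball x s" for u
  proof -
    \<comment> \<open>\<open>lip\<close> is used from \<open>x\<close> to \<open>u\<close>, so only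
      \<open>(p x, u)\<close> has to be near the base point and closeness of \<open>p u\<close> is
      not presupposed.\<close>
    have "\<bar>p x - p u\<bar> \<le> L / \<mu> * norm (x - u)"
      by (rule lip) (use u s r in \<open>auto simp: dist_Pair_Pair\<close>)
    also have "\<dots> \<le> (L + 1) / \<mu> * norm (x - u)"
      using mu by (intro mult_right_mono divide_right_mono) auto
    also have "\<dots> < (L + 1) / \<mu> * (r * \<mu> / (2 * (L + 1)))"
      using u mu L0 unfolding s_def by (intro mult_strict_left_mono) (auto simp: dist_norm)
    also have "\<dots> = r / 2" using mu L0 by (simp add: divide_simps)
    finally show ?thesis by (simp add: abs_minus_commute)
  qed
  have inb: "(p u, u') \<in> ball ?zx r" if "u \<in> ball x s" "u' \<in> ball x s" for u u'
  proof -
    have "dist ?zx (p u, u') \<le> dist (p x) (p u) + dist x u'"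
      unfolding dist_Pair_Pair by (simp add: sqrt_sum_squares_le_sum)
    also have "\<dots> < r"
      using px[OF that(1)] that(2) s by (auto simp: dist_real_def abs_minus_commute)
    finally show ?thesis by simp
  qed
  show ?thesis
  proof (rule ssd_atI[of s "C * (L / \<mu> + 1)\<^sup>2 / \<mu>" "L / \<mu>"])
    show "(L / \<mu>)-lipschitz_on (ball x s) p"
      by (rule lipschitz_onI) (use lip inb mu L0 in \<open>auto simp: dist_norm\<close>)
    show "\<exists>d. has_dir_deriv p y v d" for y v using dp by blast
  next
    fix y d assume y: "y \<in> ball x s" and d: "has_dir_deriv p y (y - x) d"
    let ?z = "(p y, y)"
    obtain q where "has_dir_deriv p y (y - x) q" and Hq: "has_dir_deriv H ?z (q, y - x) 0"
      using dp by blast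
    with d have q: "d = q" using has_dir_deriv_unique by blast
    obtain e where e: "has_dir_deriv H ?z (?z - ?zx) e" using ssd_at_dir_deriv_ex[OF H] by blast
    have "norm (?z - ?zx) \<le> \<bar>p y - p x\<bar> + norm (y - x)"
      using sqrt_sum_squares_le_sum_abs[of "p y - p x" "norm (y - x)"] by (simp add: norm_Pair)
    also have "\<dots> \<le> L / \<mu> * norm (y - x) + norm (y - x)"
      using lip[of y x] inb y s by auto
    finally have zz: "norm (?z - ?zx) \<le> (L / \<mu> + 1) * norm (y - x)" by (simp add: algebra_simps)
    \<comment> \<open>\<open>H\<close> vanishes at both \<open>?z\<close> and \<open>?zx\<close>, so
      its remainder is just \<open>- e\<close>. Both directions share the component
      \<open>y - x\<close>, and monotonicity isolates the first components.\<close>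
    have "\<mu> * \<bar>(p y - p x) - q\<bar> \<le> \<bar>e - 0\<bar>"
      using dmono_abs[of ?z "p y - p x" "y - x" e q 0] e Hq by simp
    also have "\<dots> \<le> C * (norm (?z - ?zx))\<^sup>2"
      using E[OF inb[OF y y] e] by (simp add: root)
    also have "\<dots> \<le> C * ((L / \<mu> + 1) * norm (y - x))\<^sup>2"
      using zz C by (intro mult_left_mono power_mono) auto
    also have "\<dots> = \<mu> * (C * (L / \<mu> + 1)\<^sup>2 / \<mu> * (norm (y - x))\<^sup>2)"
      using mu by (simp add: power_mult_distrib)
    finally show "norm (p y - p x - d) \<le> C * (L / \<mu> + 1)\<^sup>2 / \<mu> * (norm (y - x))\<^sup>2"
      unfolding q real_norm_def using mu by (rule mult_left_le_imp_le)
  qed (use s C mu L0 in auto)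
qed

section \<open>Soft thresholding\<close>

text \<open>For \<open>w s = s\<close> and a nonnegative threshold this is the vector shrinkage
  operator. The inner \<open>max 0\<close> makes negative thresholds return \<open>w\<close> itself,
  which prevents a jump at \<open>fst z = 0\<close>; there, division by zero gives the value
  \<open>0\<close>.\<close>

definition soft :: "('a::real_normed_vector \<Rightarrow> 'b::real_normed_vector) \<Rightarrow> 'a \<times> real \<Rightarrow> 'b" where
  "soft w z = (max 0 (norm (fst z) - max 0 (snd z)) / norm (fst z)) *\<^sub>R w (fst z)"

text \<open>The direction factor \<open>u\<close> is bounded by \<open>L\<close> but may jump at
  \<open>0\<close>. The amplitude satisfies \<open>m z' \<le> norm (fst z')\<close>, and multiplying
  by that norm restores a Lipschitz bound. Amplitude and direction contribute \<open>2 * L\<close>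
  each.\<close>

lemma lipschitz_on_soft:
  fixes w :: "'a::real_normed_vector \<Rightarrow> 'b::real_normed_vector"
  assumes L: "L-lipschitz_on UNIV w" and w0: "w 0 = 0"
  shows "(4 * L)-lipschitz_on UNIV (soft w)"
proof (rule lipschitz_onI)
  have L0: "L \<ge> 0" using L lipschitz_on_nonneg by auto
  then show "4 * L \<ge> 0" by simp
  fix z z' :: "'a \<times> real"
  define m where "m = (\<lambda>z::'a \<times> real. max 0 (norm (fst z) - max 0 (snd z)))"
  define u where "u = (\<lambda>s. (1 / norm s) *\<^sub>R w s)"
  have sw: "soft w z = m z *\<^sub>R u (fst z)" for z
    unfolding soft_def m_def u_def by simp
  have ws: "norm (w s - w s') \<le> L * norm (s - s')" for s s'
    using lipschitz_onD[OF L, of s s'] by (simp add: dist_norm)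
  have wb: "norm (w s) \<le> L * norm s" for s using ws[of s 0] w0 by simp
  have u: "norm (u s) \<le> L" for s
    using wb[of s] L0 by (cases "s = 0") (auto simp: u_def field_simps)
  have d1: "norm (fst z - fst z') \<le> dist z z'" "\<bar>snd z - snd z'\<bar> \<le> dist z z'"
    by (metis dist_norm dist_fst_le, metis dist_real_def dist_snd_le)
  have "\<bar>m z - m z'\<bar> \<le> norm (fst z - fst z') + \<bar>snd z - snd z'\<bar>"
    using norm_triangle_ineq3[of "fst z" "fst z'"] unfolding m_def by (auto simp: max_def)
  with d1 have m: "\<bar>m z - m z'\<bar> \<le> 2 * dist z z'" by simp
  have mn: "0 \<le> m z'" "m z' \<le> norm (fst z')" unfolding m_def by auto
  have one: "norm ((m z - m z') *\<^sub>R u s) \<le> 2 * L * dist z z'" for s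
    using mult_mono[OF m u[of s]] by (simp add: ac_simps)
  show "dist (soft w z) (soft w z') \<le> 4 * L * dist z z'"
  proof (cases "fst z = 0 \<or> fst z' = 0")
    case True
    then have "(m z = 0 \<or> m z' = 0) \<and> (u (fst z) = 0 \<or> u (fst z') = 0)"
      unfolding m_def u_def by auto
    moreover have "fst z = 0 \<Longrightarrow> m z = 0 \<and> u (fst z) = 0" "fst z' = 0 \<Longrightarrow> m z' = 0 \<and> u (fst z') = 0"
      unfolding m_def u_def by auto
    ultimately have "\<exists>s. norm (soft w z - soft w z') = norm ((m z - m z') *\<^sub>R u s)"
      using True unfolding sw by (auto intro: exI[of _ "fst z"] exI[of _ "fst z'"])
    then have "dist (soft w z) (soft w z') \<le> 2 * L * dist z z'"
      unfolding dist_norm[of "soft w z"] using one by metis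
    then show ?thesis using L0 zero_le_dist[of z z'] by (smt (verit) mult_right_mono)
  next
    case False
    let ?s = "fst z" and ?s' = "fst z'"
    have "norm (m z' *\<^sub>R (u ?s - u ?s')) \<le> norm ?s' * norm (u ?s - u ?s')"
      using mn by (simp add: mult_right_mono)
    also have "\<dots> = norm ((norm ?s' / norm ?s) *\<^sub>R w ?s - w ?s')"
    proof -
      have "(norm ?s' / norm ?s) *\<^sub>R w ?s - w ?s' = norm ?s' *\<^sub>R (u ?s - u ?s')"
        unfolding u_def using False by (simp add: scaleR_diff_right)
      then show ?thesis by simp
    qed
    also have "(norm ?s' / norm ?s) *\<^sub>R w ?s - w ?s' = (norm ?s' - norm ?s) *\<^sub>R u ?s + (w ?s - w ?s')"
      unfolding u_def using False by (simp add: algebra_simps diff_divide_distrib)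
    also have "norm \<dots> \<le> \<bar>norm ?s' - norm ?s\<bar> * L + L * norm (?s - ?s')"
      using norm_triangle_mono[OF _ ws] u by (simp add: mult_left_mono)
    also have "\<dots> \<le> 2 * L * dist z z'"
    proof -
      have "\<bar>norm ?s' - norm ?s\<bar> \<le> dist z z'"
        using norm_triangle_ineq3[of ?s ?s'] d1 by simp
      with d1 L0 have "\<bar>norm ?s' - norm ?s\<bar> * L \<le> dist z z' * L" "L * norm (?s - ?s') \<le> L * dist z z'"
        by (auto intro: mult_right_mono mult_left_mono)
      then show ?thesis by (simp add: algebra_simps)
    qed
    finally have two: "norm (m z' *\<^sub>R (u ?s - u ?s')) \<le> 2 * L * dist z z'" .
    have "soft w z - soft w z' = (m z - m z') *\<^sub>R u ?s + m z' *\<^sub>R (u ?s - u ?s')"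
      unfolding sw by (simp add: algebra_simps)
    then have "dist (soft w z) (soft w z') \<le> norm ((m z - m z') *\<^sub>R u ?s) + norm (m z' *\<^sub>R (u ?s - u ?s'))"
      unfolding dist_norm[of "soft w z"] by (metis norm_triangle_ineq)
    with one[of ?s] two show ?thesis by linarith
  qed
qed

text \<open>Homogeneity handles the origin of the product space. At other points with zero first
  component, \<open>soft w\<close> is locally zero if the threshold is positive and locally
  \<open>w\<close> of the first component if it is negative.\<close>

lemma ssd_at_soft:
  fixes w :: "'a::real_inner \<Rightarrow> 'b::real_normed_vector"
  assumes hom: "\<And>t s. t > 0 \<Longrightarrow> w (t *\<^sub>R s) = t *\<^sub>R w s"
    and L: "L-lipschitz_on UNIV w"
    and off: "\<And>s. s \<noteq> 0 \<Longrightarrow> ssd_at w s"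
  shows "ssd_at (soft w) z"
proof (rule ssd_at_homogeneous[where L = "4 * L"])
  have w0: "w 0 = 0"
  proof -
    have "w 0 = 2 *\<^sub>R w 0" using hom[of 2 0] by simp
    then show ?thesis by (simp add: scaleR_2)
  qed
  show "(4 * L)-lipschitz_on UNIV (soft w)" by (rule lipschitz_on_soft[OF L w0])
  show "soft w (t *\<^sub>R y) = t *\<^sub>R soft w y" if "t > 0" for t y
  proof -
    have "max 0 (t * norm (fst y) - max 0 (t * snd y)) = t * max 0 (norm (fst y) - max 0 (snd y))"
      using that by (simp add: max_mult_distrib_left right_diff_distrib)
    then show ?thesis using that by (simp add: soft_def hom)
  qed
  show "ssd_at (soft w) y" if y: "y \<noteq> 0" for y
  proof (cases "fst y = 0")
    case False
    then show ?thesis unfolding soft_def[abs_def]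
      by (intro ssd_at_scaleR ssd_at_divide ssd_at_max ssd_at_diff ssd_at_const ssd_at_norm
          ssd_at_fst ssd_at_snd ssd_at_ident ssd_at_compose[where F = fst and G = w] off) auto
  next
    case s: True
    with y have a: "snd y \<noteq> 0" by (metis prod.collapse zero_prod_def)
    show ?thesis
    proof (cases "snd y > 0")
      case True
      have "0 = soft w v" if "v \<in> ball y (snd y / 2)" for v
      proof -
        have "dist (fst y) (fst v) < snd y / 2" "dist (snd y) (snd v) < snd y / 2"
          using that dist_fst_le[of y v] dist_snd_le[of y v] by auto
        then have "norm (fst v) < snd y / 2" "snd v > snd y / 2"
          using s by (auto simp: dist_real_def abs_if field_simps split: if_splits)
        then have "norm (fst v) \<le> max 0 (snd v)" by linarith
        then show ?thesis unfolding soft_def by simp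
      qed
      then show ?thesis
        using ssd_at_cong[OF ssd_at_const[of 0 y], of "snd y / 2" "soft w"] True by simp
    next
      case False
      have "w (fst v) = soft w v" if "v \<in> ball y \<bar>snd y\<bar>" for v
      proof -
        have "dist (snd y) (snd v) < \<bar>snd y\<bar>"
          using that dist_snd_le[of y v] by auto
        then have "snd v \<le> 0" using False by (simp add: dist_real_def)
        then show ?thesis unfolding soft_def by (simp add: max_def w0)
      qed
      moreover have "ssd_at (\<lambda>v. w (fst v)) y"
        by (intro ssd_at_compose[where F = fst and G = w] ssd_at_fst ssd_at_ident
            ssd_at_homogeneous[OF hom L off])
      ultimately show ?thesis
        using ssd_at_cong[of "\<lambda>v. w (fst v)" y "\<bar>snd y\<bar>" "soft w"] a by simp
    qed
  qed
qed

section \<open>The largest eigenvalue\<close>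

text \<open>For symmetric \<open>A\<close> this is the largest eigenvalue, in general that of the
  symmetric part. As a supremum of functions linear in \<open>A\<close> it is convex on all
  matrices.\<close>

definition qmax :: "real^'n^'n \<Rightarrow> real" where
  "qmax A = (SUP v\<in>sphere 0 1. v \<bullet> (A *v v))"

lemma qmax_attained:
  fixes A :: "real^'n^'n"
  obtains v where "norm v = 1" "qmax A = v \<bullet> (A *v v)" "\<And>w. norm w = 1 \<Longrightarrow> w \<bullet> (A *v w) \<le> qmax A"
proof -
  have "norm (axis undefined 1 :: real^'n) = 1" by simp
  then have ne: "sphere 0 1 \<noteq> ({} :: (real^'n) set)" by (metis dist_0_norm empty_iff mem_sphere)
  have "continuous_on (sphere 0 1) (\<lambda>v. v \<bullet> (A *v v))"
    by (intro continuous_intros linear_continuous_on) (simp add: matrix_vector_mul_bounded_linear)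
  then obtain v where v: "v \<in> sphere 0 1" "\<And>w. w \<in> sphere 0 1 \<Longrightarrow> w \<bullet> (A *v w) \<le> v \<bullet> (A *v v)"
    using continuous_attains_sup[OF compact_sphere ne] by blast
  have "qmax A = v \<bullet> (A *v v)"
    unfolding qmax_def by (rule cSup_eq_maximum) (use v in auto)
  with v that show ?thesis by auto
qed

lemma qmax_ge: "norm v = 1 \<Longrightarrow> v \<bullet> (A *v v) \<le> qmax A"
  by (metis qmax_attained)

lemma qmax_ge_scaled: "v \<bullet> (A *v v) \<le> qmax A * (v \<bullet> v)"
proof (cases "v = 0")
  case False
  let ?w = "(1 / norm v) *\<^sub>R v"
  have "?w \<bullet> (A *v ?w) \<le> qmax A" using False by (intro qmax_ge) simp
  moreover have "?w \<bullet> (A *v ?w) = (v \<bullet> (A *v v)) / (v \<bullet> v)"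
    using False by (simp add: matrix_vector_mult_scaleR power2_norm_eq_inner[symmetric] power2_eq_square)
  ultimately have "(v \<bullet> (A *v v)) / (v \<bullet> v) \<le> qmax A" by simp
  then show ?thesis using False by (simp add: divide_le_eq)
qed simp

lemma norm_matrix_vector_mult_le:
  fixes A :: "real^'n^'m"
  shows "norm (A *v x) \<le> norm A * norm x"
proof -
  have "norm (A *v x) = L2_set (\<lambda>i. norm (A $ i \<bullet> x)) UNIV"
    unfolding norm_vec_def by (simp add: matrix_vector_mult_def inner_vec_def)
  also have "\<dots> \<le> L2_set (\<lambda>i. norm (A $ i) * norm x) UNIV"
    by (intro L2_set_mono) (auto intro: Cauchy_Schwarz_ineq2)
  also have "\<dots> = norm A * norm x"
    by (simp add: norm_vec_def[of A] L2_set_left_distrib)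
  finally show ?thesis .
qed

lemma quadratic_form_le: "norm v = 1 \<Longrightarrow> \<bar>v \<bullet> (A *v v)\<bar> \<le> norm (A :: real^'n^'n)"
  using Cauchy_Schwarz_ineq2[of v "A *v v"] norm_matrix_vector_mult_le[of A v] by simp

text \<open>A maximiser for one matrix competes in the supremum for the other.\<close>

lemma lipschitz_on_qmax: "1-lipschitz_on UNIV (qmax :: real^'n^'n \<Rightarrow> real)"
proof (rule lipschitz_onI)
  have *: "qmax A \<le> qmax B + norm (A - B)" for A B :: "real^'n^'n"
  proof -
    obtain v where v: "norm v = 1" "qmax A = v \<bullet> (A *v v)" using qmax_attained[of A] by metis
    have "qmax A = v \<bullet> (B *v v) + v \<bullet> ((A - B) *v v)"
      unfolding v by (simp add: matrix_vector_mult_diff_rdistrib inner_diff_right)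
    then show ?thesis using qmax_ge[OF v(1), of B] quadratic_form_le[OF v(1), of "A - B"] by linarith
  qed
  show "dist (qmax A) (qmax B) \<le> 1 * dist A B" for A B :: "real^'n^'n"
    using *[of A B] *[of B A] by (simp add: dist_norm norm_minus_commute abs_le_iff)
qed simp

section \<open>Positive semidefinite forms and the second-order estimate\<close>

text \<open>The form at \<open>x - t *\<^sub>R y\<close> is a nonnegative quadratic in
  \<open>t\<close>; the degenerate case has a vanishing leading coefficient.\<close>

lemma psd_Cauchy_Schwarz:
  fixes N :: "real^'n^'n"
  assumes sym: "transpose N = N" and psd: "\<And>x. 0 \<le> x \<bullet> (N *v x)"
  shows "(x \<bullet> (N *v y))\<^sup>2 \<le> (x \<bullet> (N *v x)) * (y \<bullet> (N *v y))"
proof -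
  let ?a = "y \<bullet> (N *v y)" and ?b = "x \<bullet> (N *v y)" and ?c = "x \<bullet> (N *v x)"
  have sw: "y \<bullet> (N *v x) = ?b"
    using sym by (metis dot_lmul_matrix inner_commute transpose_matrix_vector)
  have q: "0 \<le> ?c - 2 * t * ?b + t\<^sup>2 * ?a" for t
  proof -
    have "0 \<le> (x - t *\<^sub>R y) \<bullet> (N *v (x - t *\<^sub>R y))" by (rule psd)
    also have "\<dots> = ?c - 2 * t * ?b + t\<^sup>2 * ?a"
      by (simp add: matrix_vector_mult_diff_distrib matrix_vector_mult_scaleR inner_diff_left
          inner_diff_right sw power2_eq_square algebra_simps)
    finally show ?thesis .
  qed
  show ?thesis
  proof (cases "?a = 0")
    case True
    have "?b = 0"
    proof (rule ccontr)
      assume b: "?b \<noteq> 0"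
      \<comment> \<open>This \<open>t\<close> makes the right-hand side equal to
        \<open>-1\<close>.\<close>
      have "0 \<le> ?c - 2 * ((?c + 1) / (2 * ?b)) * ?b" using q[of "(?c + 1) / (2 * ?b)"] True by simp
      then show False using b by simp
    qed
    then show ?thesis by (simp add: True)
  next
    case False
    then have a: "?a > 0" using psd[of y] by simp
    have "0 \<le> ?c - 2 * (?b / ?a) * ?b + (?b / ?a)\<^sup>2 * ?a" by (rule q)
    also have "\<dots> = ?c - ?b\<^sup>2 / ?a" using a by (simp add: power2_eq_square field_simps)
    finally show ?thesis using a by (simp add: field_simps)
  qed
qed

text \<open>Taking \<open>x = N *v v\<close> in the Cauchy-Schwarz inequality bounds the fourth
  power of \<open>norm (N *v v)\<close> by \<open>0\<close>.\<close>

lemma psd_kernel: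
  fixes N :: "real^'n^'n"
  assumes "transpose N = N" "\<And>x. 0 \<le> x \<bullet> (N *v x)" "v \<bullet> (N *v v) = 0"
  shows "N *v v = 0"
  using psd_Cauchy_Schwarz[OF assms(1,2), of "N *v v" v] assms(3) by simp

text \<open>The spectral gap of \<open>N\<close> above its kernel, without eigenvalues.\<close>

lemma quadratic_form_le_norm_sq:
  fixes N :: "real^'n^'n"
  assumes sym: "transpose N = N"
  shows "\<exists>C\<ge>0. \<forall>v. v \<bullet> (N *v v) \<le> C * (norm (N *v v))\<^sup>2"
proof -
  define K where "K = {v. N *v v = 0}"
  have K: "subspace K" "span K = K"
    unfolding K_def by (auto simp: subspace_def matrix_vector_right_distrib matrix_vector_mult_scaleR)
  define P where "P = {z. \<forall>w\<in>K. orthogonal z w}"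
  have P: "subspace P"
    unfolding P_def by (auto simp: subspace_def orthogonal_def inner_add_left)
  have inj: "\<forall>z\<in>P. N *v z = 0 \<longrightarrow> z = 0"
    unfolding P_def K_def by (auto simp: orthogonal_def)
  \<comment> \<open>On the orthogonal complement of its kernel \<open>N\<close> is injective, hence
    bounded below in finite dimension; this \<open>c\<close> plays the role of the spectral
    gap.\<close>
  obtain c where c: "c > 0" "\<And>z. z \<in> P \<Longrightarrow> c * norm z \<le> norm (N *v z)"
    using injective_imp_isometric[OF closed_subspace[OF P] P matrix_vector_mul_bounded_linear inj] by blast
  have "v \<bullet> (N *v v) \<le> (norm N / c\<^sup>2) * (norm (N *v v))\<^sup>2" for v
  proof -
    obtain y z where y: "y \<in> K" and z: "\<And>w. w \<in> K \<Longrightarrow> orthogonal z w" and v: "v = y + z"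
      using orthogonal_subspace_decomp_exists[of K v] K by metis
    have Ny: "N *v y = 0" using y unfolding K_def by simp
    have zP: "z \<in> P" using z unfolding P_def by simp
    have Nv: "N *v v = N *v z" unfolding v by (simp add: matrix_vector_right_distrib Ny)
    have "y \<bullet> (N *v z) = 0"
      using sym Ny by (metis dot_lmul_matrix inner_zero_left transpose_matrix_vector)
    then have "v \<bullet> (N *v v) = z \<bullet> (N *v z)" unfolding Nv by (simp add: v inner_add_left)
    also have "\<dots> \<le> norm z * norm (N *v z)" by (rule norm_cauchy_schwarz)
    also have "\<dots> \<le> norm z * (norm N * norm z)"
      by (intro mult_left_mono norm_matrix_vector_mult_le) simp
    also have "\<dots> = (norm N / c\<^sup>2) * (c * norm z)\<^sup>2"
      using c by (simp add: power2_eq_square)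
    also have "\<dots> \<le> (norm N / c\<^sup>2) * (norm (N *v z))\<^sup>2"
      using c(2)[OF zP] c(1) by (intro mult_left_mono power_mono) auto
    finally show ?thesis unfolding Nv .
  qed
  then show ?thesis using c by (intro exI[of _ "norm N / c\<^sup>2"]) auto
qed

definition symm :: "real^'n^'n \<Rightarrow> real^'n^'n" where
  "symm A = (1/2) *\<^sub>R (A + transpose A)"

lemma symm_diff: "symm (A - B) = symm A - symm B"
  unfolding symm_def by (simp add: transpose_def vec_eq_iff field_simps)

lemma quadratic_form_symm: "v \<bullet> (symm A *v v) = v \<bullet> (A *v v)"
proof -
  have "v \<bullet> (transpose A *v v) = v \<bullet> (A *v v)"
    by (metis dot_lmul_matrix inner_commute transpose_matrix_vector transpose_transpose)
  then show ?thesis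
    unfolding symm_def
    by (simp add: scaleR_matrix_vector_assoc[symmetric] matrix_vector_mult_add_rdistrib inner_add_right)
qed

lemma norm_symm_le: "norm (symm A) \<le> norm (A :: real^'n^'n)"
proof -
  have "norm (transpose A) = norm A"
    unfolding norm_eq_sqrt_inner inner_vec_def transpose_def
    by (simp, rule sum.swap)
  then show ?thesis
    unfolding symm_def using norm_triangle_ineq[of A "transpose A"] by simp
qed

lemma qmax_psd:
  fixes A :: "real^'n^'n"
  shows "0 \<le> x \<bullet> ((qmax A *\<^sub>R mat 1 - symm A) *v x)"
  using qmax_ge_scaled[of x A]
  by (simp add: matrix_vector_mult_diff_rdistrib scaleR_matrix_vector_assoc[symmetric]
      inner_diff_right quadratic_form_symm)

lemma transpose_qmax_psd: "transpose (c *\<^sub>R mat 1 - symm A) = c *\<^sub>R mat 1 - symm (A :: real^'n^'n)"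
  unfolding symm_def by (auto simp: transpose_def vec_eq_iff mat_def)

text \<open>At a maximiser the positive semidefinite form of
  \<open>qmax A *\<^sub>R mat 1 - symm A\<close> vanishes, so the maximiser lies in its
  kernel.\<close>

lemma qmax_eigenvector:
  fixes A :: "real^'n^'n"
  assumes "norm v = 1" "v \<bullet> (A *v v) = qmax A"
  shows "symm A *v v = qmax A *\<^sub>R v"
proof -
  have "(qmax A *\<^sub>R mat 1 - symm A) *v v = 0"
    by (rule psd_kernel[OF transpose_qmax_psd qmax_psd])
      (use assms in \<open>simp add: matrix_vector_mult_diff_rdistrib scaleR_matrix_vector_assoc[symmetric]
      inner_diff_right quadratic_form_symm power2_norm_eq_inner[symmetric]\<close>)
  then show ?thesis
    by (simp add: matrix_vector_mult_diff_rdistrib scaleR_matrix_vector_assoc[symmetric])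
qed

text \<open>A maximiser for \<open>Y\<close> is off the top eigenspace of \<open>X\<close> by only \<open>O(\<parallel>Y - X\<parallel>)\<close>, so its
  Rayleigh quotient at \<open>X\<close> misses \<open>qmax X\<close> by a second-order term.\<close>

lemma qmax_second_order:
  fixes X :: "real^'n^'n"
  obtains C where "C \<ge> 0"
    "\<And>Y v. norm v = 1 \<Longrightarrow> v \<bullet> (Y *v v) = qmax Y \<Longrightarrow> qmax X - v \<bullet> (X *v v) \<le> C * (norm (Y - X))\<^sup>2"
proof -
  let ?N = "qmax X *\<^sub>R mat 1 - symm X"
  obtain C where C: "C \<ge> 0" "\<And>v. v \<bullet> (?N *v v) \<le> C * (norm (?N *v v))\<^sup>2"
    using quadratic_form_le_norm_sq[OF transpose_qmax_psd] by blast
  have "qmax X - v \<bullet> (X *v v) \<le> (4 * C) * (norm (Y - X))\<^sup>2"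
    if v: "norm v = 1" "v \<bullet> (Y *v v) = qmax Y" for Y v
  proof -
    \<comment> \<open>\<open>v\<close> is an eigenvector of \<open>symm Y\<close>, so both terms
      have size \<open>norm (Y - X)\<close>; the square of their sum yields the factor 4.\<close>
    have "?N *v v = (qmax X - qmax Y) *\<^sub>R v + symm (Y - X) *v v"
      by (simp add: matrix_vector_mult_diff_rdistrib scaleR_matrix_vector_assoc[symmetric]
          symm_diff qmax_eigenvector[OF v] scaleR_diff_left)
    then have "norm (?N *v v) \<le> \<bar>qmax X - qmax Y\<bar> + norm (symm (Y - X) *v v)"
      using norm_triangle_ineq[of "(qmax X - qmax Y) *\<^sub>R v" "symm (Y - X) *v v"] v by simp
    also have "\<dots> \<le> norm (Y - X) + norm (Y - X)"
      using lipschitz_onD[OF lipschitz_on_qmax, of X Y] norm_matrix_vector_mult_le[of "symm (Y - X)" v]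
        norm_symm_le[of "Y - X"] v by (simp add: dist_norm norm_minus_commute)
    finally have "(norm (?N *v v))\<^sup>2 \<le> (2 * norm (Y - X))\<^sup>2" by (intro power_mono) auto
    then have "C * (norm (?N *v v))\<^sup>2 \<le> C * (4 * (norm (Y - X))\<^sup>2)"
      using C(1) by (intro mult_left_mono) (auto simp: power_mult_distrib)
    with C(2)[of v] have "v \<bullet> (?N *v v) \<le> 4 * C * (norm (Y - X))\<^sup>2" by simp
    then show ?thesis using v
      by (simp add: matrix_vector_mult_diff_rdistrib scaleR_matrix_vector_assoc[symmetric]
          inner_diff_right quadratic_form_symm power2_norm_eq_inner[symmetric])
  qed
  with that[of "4 * C"] C(1) show ?thesis by auto
qed

lemma qmax_add_le: "qmax (A + B) \<le> qmax A + qmax (B :: real^'n^'n)"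
proof -
  obtain v where v: "norm v = 1" "qmax (A + B) = v \<bullet> ((A + B) *v v)"
    using qmax_attained[of "A + B"] by metis
  then show ?thesis using qmax_ge[OF v(1), of A] qmax_ge[OF v(1), of B]
    by (simp add: matrix_vector_mult_add_rdistrib inner_add_right)
qed

lemma qmax_scaleR: "t \<ge> 0 \<Longrightarrow> qmax (t *\<^sub>R A) = t * qmax (A :: real^'n^'n)"
proof (rule antisym)
  assume t: "t \<ge> 0"
  obtain v where v: "norm v = 1" "qmax (t *\<^sub>R A) = v \<bullet> ((t *\<^sub>R A) *v v)"
    using qmax_attained[of "t *\<^sub>R A"] by metis
  then show "qmax (t *\<^sub>R A) \<le> t * qmax A" using qmax_ge[OF v(1), of A] t
    by (simp add: scaleR_matrix_vector_assoc[symmetric] mult_left_mono)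
  obtain w where w: "norm w = 1" "qmax A = w \<bullet> (A *v w)"
    using qmax_attained[of A] by metis
  then show "t * qmax A \<le> qmax (t *\<^sub>R A)" using qmax_ge[OF w(1), of "t *\<^sub>R A"] t
    by (simp add: scaleR_matrix_vector_assoc[symmetric])
qed

lemma abs_qmax_le: "\<bar>qmax A\<bar> \<le> norm (A :: real^'n^'n)"
  using lipschitz_onD[OF lipschitz_on_qmax, of A 0] qmax_scaleR[of 0 A] by (simp add: dist_norm)

section \<open>Strong semismoothness of the largest eigenvalue\<close>

text \<open>By convexity the difference quotient is monotone in \<open>t\<close>, and the Lipschitz
  bound keeps it bounded below; the one-sided limit is its infimum.\<close>

lemma qmax_dir_deriv_ex:
  fixes Y :: "real^'n^'n"
  shows "\<exists>d. has_dir_deriv qmax Y H d"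
proof -
  define q where "q = (\<lambda>t. (1 / t) *\<^sub>R (qmax (Y + t *\<^sub>R H) - qmax Y))"
  have bound: "- norm H \<le> q t" if "t > 0" for t
    using lipschitz_onD[OF lipschitz_on_qmax, of "Y + t *\<^sub>R H" Y] that
    unfolding q_def by (auto simp: dist_norm field_simps abs_le_iff)
  have mono: "q s \<le> q t" if st: "0 < s" "s \<le> t" for s t
  proof -
    have "Y + s *\<^sub>R H = (1 - s / t) *\<^sub>R Y + (s / t) *\<^sub>R (Y + t *\<^sub>R H)"
      using st by (simp add: algebra_simps)
    then have "qmax (Y + s *\<^sub>R H) \<le> (1 - s / t) * qmax Y + (s / t) * qmax (Y + t *\<^sub>R H)"
      using qmax_add_le[of "(1 - s / t) *\<^sub>R Y" "(s / t) *\<^sub>R (Y + t *\<^sub>R H)"] st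
      by (simp add: qmax_scaleR)
    then have "qmax (Y + s *\<^sub>R H) - qmax Y \<le> (s / t) * (qmax (Y + t *\<^sub>R H) - qmax Y)"
      by (simp add: algebra_simps)
    then show ?thesis unfolding q_def using st by (simp add: field_simps)
  qed
  define l where "l = Inf (q ` {0<..})"
  have bdd: "bdd_below (q ` {0<..})" using bound by (auto simp: bdd_below_def)
  have "(q \<longlongrightarrow> l) (at_right 0)"
  proof (rule order_tendstoI)
    fix a assume "a < l"
    then have "a < q t" if "t > 0" for t
      using cInf_lower[OF _ bdd, of "q t"] that unfolding l_def by fastforce
    then show "\<forall>\<^sub>F t in at_right 0. a < q t"
      using eventually_right_pos by (auto elim: eventually_mono)
  next
    fix a assume "l < a"
    then obtain t where t: "t > 0" "q t < a"
      using cInf_lessD[of "q ` {0<..}" a] unfolding l_def by auto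
    have "\<forall>\<^sub>F s in at_right 0. s < t" using t(1)
      by (rule eventually_at_right_real[THEN eventually_mono]) auto
    then show "\<forall>\<^sub>F s in at_right 0. q s < a"
      using eventually_right_pos
    proof eventually_elim
      case (elim s)
      then show ?case using mono[of s t] t by simp
    qed
  qed
  then show ?thesis unfolding has_dir_deriv_def q_def by blast
qed

text \<open>Convexity gives \<open>qmax Y - qmax X \<le> d\<close>. The opposite bound up to second
  order uses maximisers at points slightly beyond \<open>Y\<close> on the ray from
  \<open>X\<close>.\<close>

lemma ssd_at_qmax: "ssd_at qmax (X :: real^'n^'n)"
proof -
  obtain C where C: "C \<ge> 0" and S: "\<And>Y v. norm v = 1 \<Longrightarrow> v \<bullet> (Y *v v) = qmax Y \<Longrightarrow>
      qmax X - v \<bullet> (X *v v) \<le> C * (norm (Y - X))\<^sup>2"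
    using qmax_second_order[of X] by metis
  show ?thesis
  proof (rule ssd_atI[of 1 C 1])
    show "1-lipschitz_on (ball X 1) (qmax :: real^'n^'n \<Rightarrow> real)"
      using lipschitz_on_qmax by (rule lipschitz_on_subset) simp
  next
    fix Y d assume d: "has_dir_deriv qmax Y (Y - X) d"
    let ?H = "Y - X"
    let ?q = "\<lambda>t. (1 / t) *\<^sub>R (qmax (Y + t *\<^sub>R ?H) - qmax Y)"
    have lim: "(?q \<longlongrightarrow> d) (at_right 0)" using d unfolding has_dir_deriv_def .
    obtain v where v: "norm v = 1" "qmax Y = v \<bullet> (Y *v v)" using qmax_attained[of Y] by metis
    have "\<forall>\<^sub>F t in at_right 0. qmax Y - qmax X \<le> ?q t"
      using eventually_right_pos
    proof eventually_elim
      case (elim t)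
      have "qmax Y + t * (v \<bullet> (?H *v v)) \<le> qmax (Y + t *\<^sub>R ?H)"
        using qmax_ge[OF v(1), of "Y + t *\<^sub>R ?H"] v
        by (simp add: matrix_vector_mult_add_rdistrib scaleR_matrix_vector_assoc[symmetric] inner_add_right)
      then have "v \<bullet> (?H *v v) \<le> ?q t" using elim by (simp add: field_simps)
      moreover have "v \<bullet> (?H *v v) \<ge> qmax Y - qmax X"
        using qmax_ge[OF v(1), of X] v by (simp add: matrix_vector_mult_diff_rdistrib inner_diff_right)
      ultimately show ?case by simp
    qed
    then have lower: "qmax Y - qmax X \<le> d" by (rule tendsto_lowerbound[OF lim]) simp
    \<comment> \<open>A maximiser \<open>w\<close> at \<open>?Z\<close> bounds the quotient by its
      form at \<open>?H\<close>. Since \<open>?Z - X\<close> is \<open>(1 + t) *\<^sub>R ?H\<close>,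
      this equals a scaled increment from \<open>X\<close>, to which the second-order estimate
      \<open>S\<close> applies.\<close>
    have "\<forall>\<^sub>F t in at_right 0. ?q t \<le> (qmax (Y + t *\<^sub>R ?H) - qmax X + C * ((1 + t) * norm ?H)\<^sup>2) / (1 + t)"
      using eventually_right_pos
    proof eventually_elim
      case (elim t)
      let ?Z = "Y + t *\<^sub>R ?H"
      obtain w where w: "norm w = 1" "qmax ?Z = w \<bullet> (?Z *v w)" using qmax_attained[of ?Z] by metis
      have ZX: "?Z - X = (1 + t) *\<^sub>R ?H" by (simp add: algebra_simps)
      have "w \<bullet> (?Z *v w) = w \<bullet> (Y *v w) + t * (w \<bullet> (?H *v w))"
        by (simp add: matrix_vector_mult_add_rdistrib scaleR_matrix_vector_assoc[symmetric] inner_add_right)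
      then have "qmax ?Z - qmax Y \<le> t * (w \<bullet> (?H *v w))"
        using qmax_ge[OF w(1), of Y] w by linarith
      then have "?q t \<le> w \<bullet> (?H *v w)" using elim by (simp add: field_simps)
      also have "w \<bullet> (?H *v w) = (qmax ?Z - w \<bullet> (X *v w)) / (1 + t)"
      proof -
        have "qmax ?Z - w \<bullet> (X *v w) = w \<bullet> ((?Z - X) *v w)"
          using w by (simp only: matrix_vector_mult_diff_rdistrib inner_diff_right)
        also have "\<dots> = (1 + t) * (w \<bullet> (?H *v w))"
          unfolding ZX by (simp add: scaleR_matrix_vector_assoc[symmetric])
        finally show ?thesis using elim by simp
      qed
      also have "\<dots> \<le> (qmax ?Z - qmax X + C * ((1 + t) * norm ?H)\<^sup>2) / (1 + t)"
        using S[OF w(1) w(2)[symmetric]] elim unfolding ZX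
        by (intro divide_right_mono) (auto simp: abs_if)
      finally show ?case .
    qed
    moreover have "((\<lambda>t. (qmax (Y + t *\<^sub>R ?H) - qmax X + C * ((1 + t) * norm ?H)\<^sup>2) / (1 + t))
        \<longlongrightarrow> (qmax Y - qmax X + C * ((1 + 0) * norm ?H)\<^sup>2) / (1 + 0)) (at_right 0)"
      by (intro tendsto_intros tendsto_of_dir_deriv[OF d]) simp
    ultimately have "d \<le> (qmax Y - qmax X + C * ((1 + 0) * norm ?H)\<^sup>2) / (1 + 0)"
      using lim tendsto_le[OF trivial_limit_at_right_real] by blast
    then have upper: "d \<le> qmax Y - qmax X + C * (norm ?H)\<^sup>2" by simp
    show "norm (qmax Y - qmax X - d) \<le> C * (norm (Y - X))\<^sup>2"
      using lower upper by simp
  qed (use C qmax_dir_deriv_ex in auto)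
qed

section \<open>Lode angle and elliptic radius\<close>

lemmas mat3_expand = inner_vec_def sum_3 Id3_def mat_def frob_def

lemma Sym3_entries:
  "A \<in> Sym3 \<longleftrightarrow> A$2$1 = A$1$2 \<and> A$3$1 = A$1$3 \<and> A$3$2 = A$2$3"
  unfolding Sym3_def by (auto simp: transpose_def vec_eq_iff forall_3)

lemma trace_entries: "Id3 :\<^sub>F A = A$1$1 + A$2$2 + A$3$3"
  by (simp add: mat3_expand)

lemma norm_sq_Sym3:
  assumes "A \<in> Sym3"
  shows "(norm A)\<^sup>2 = (A$1$1)\<^sup>2 + (A$2$2)\<^sup>2 + (A$3$3)\<^sup>2 + 2 * ((A$1$2)\<^sup>2 + (A$1$3)\<^sup>2 + (A$2$3)\<^sup>2)"
  using assms unfolding power2_norm_eq_inner Sym3_entries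
  by (simp add: mat3_expand power2_eq_square)

lemma symm_Sym3: "A \<in> Sym3 \<Longrightarrow> symm A = A"
  unfolding Sym3_def symm_def by (simp add: scaleR_2[symmetric])

lemma devp_in_Sym3: "A \<in> Sym3 \<Longrightarrow> devp A \<in> Sym3"
  unfolding Sym3_entries devp_def by (simp add: mat3_expand)

lemma trace_devp: "Id3 :\<^sub>F devp A = 0"
  unfolding devp_def by (simp add: mat3_expand) (simp add: field_simps)

lemma devp_traceless: "Id3 :\<^sub>F A = 0 \<Longrightarrow> devp A = A"
  unfolding devp_def by simp

context
  fixes s :: mat3
  assumes sym: "s \<in> Sym3" and tr: "Id3 :\<^sub>F s = 0"
begin

lemma s33: "s$3$3 = - s$1$1 - s$2$2"
  using tr unfolding trace_entries by simp

text \<open>This is the characteristic equation of a traceless symmetric matrix, whose coefficients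
  are the invariants \<open>J2\<close> (half the squared norm) and \<open>J3\<close>.\<close>

lemma qmax_root_charpoly: "(qmax s) ^ 3 = (norm s)\<^sup>2 / 2 * qmax s + J3 s"
proof -
  let ?l = "qmax s"
  obtain v where v: "norm v = 1" "v \<bullet> (s *v v) = qmax s" using qmax_attained[of s] by metis
  have "(?l *\<^sub>R mat 1 - s) *v v = 0"
    using qmax_eigenvector[OF v] unfolding symm_Sym3[OF sym]
    by (simp add: matrix_vector_mult_diff_rdistrib scaleR_matrix_vector_assoc[symmetric])
  then have "det (?l *\<^sub>R mat 1 - s) = 0"
    using v(1) by (metis invertible_det_nz invertible_left_inverse matrix_left_invertible_ker norm_zero zero_neq_one)
  moreover have "det (?l *\<^sub>R mat 1 - s) = ?l ^ 3 - (norm s)\<^sup>2 / 2 * ?l - J3 s"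
    using sym unfolding norm_sq_Sym3[OF sym] J3_def devp_traceless[OF tr] Sym3_entries
    by (simp add: det_3 mat3_expand matrix_matrix_mult_def s33 power2_eq_square power3_eq_cube)
      (simp add: field_simps)
  ultimately show ?thesis by simp
qed

text \<open>Every diagonal entry is at most \<open>qmax s\<close>, and the diagonal sums to
  \<open>0\<close>.\<close>

lemma qmax_nonneg: "0 \<le> qmax s"
proof -
  have "s$i$i \<le> qmax s" for i
    using qmax_ge[of "axis i 1" s] by (simp add: matrix_vector_mul_component inner_axis' inner_axis)
  from this[of 1] this[of 2] this[of 3] show ?thesis using s33 by simp
qed

lemma qmax_upper: "qmax s \<le> sqrt (2/3) * norm s"
proof -
  obtain v where v: "norm v = 1" "qmax s = v \<bullet> (s *v v)" using qmax_attained[of s] by metis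
  have v1: "(v$1)\<^sup>2 + (v$2)\<^sup>2 + (v$3)\<^sup>2 = 1"
    using v(1) by (simp add: norm_eq_sqrt_inner inner_vec_def sum_3 power2_eq_square)
  \<comment> \<open>\<open>M\<close> is the deviator of the dyad of \<open>v\<close> with itself.
    Pairing it with the traceless \<open>s\<close> gives \<open>qmax s\<close>, and its norm
    supplies the constant \<open>sqrt (2/3)\<close>.\<close>
  define M :: mat3 where "M = (\<chi> i j. v$i * v$j) - (1/3) *\<^sub>R mat 1"
  have "M \<bullet> M = ((v$1)\<^sup>2 + (v$2)\<^sup>2 + (v$3)\<^sup>2)\<^sup>2 - 2/3 * ((v$1)\<^sup>2 + (v$2)\<^sup>2 + (v$3)\<^sup>2) + 1/3"
    unfolding M_def by (simp add: mat3_expand power2_eq_square) (simp add: field_simps)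
  then have "norm M = sqrt (2/3)" unfolding norm_eq_sqrt_inner v1 by simp
  moreover have "s \<bullet> M = qmax s"
    unfolding M_def v(2)
    by (simp add: mat3_expand matrix_vector_mult_def s33) (simp add: algebra_simps)
  ultimately show ?thesis using norm_cauchy_schwarz[of s M] by (simp add: mult.commute)
qed

text \<open>The principal 2x2 minors of the positive semidefinite
  \<open>qmax s *\<^sub>R mat 1 - s\<close> are nonnegative; their sum is
  \<open>3 * (qmax s)\<^sup>2 - (norm s)\<^sup>2 / 2\<close>.\<close>

lemma qmax_lower: "(norm s)\<^sup>2 \<le> 6 * (qmax s)\<^sup>2"
proof -
  let ?N = "qmax s *\<^sub>R mat 1 - s"
  have N: "transpose ?N = ?N" "\<And>x. 0 \<le> x \<bullet> (?N *v x)"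
    using transpose_qmax_psd[of "qmax s" s] qmax_psd[of _ s] unfolding symm_Sym3[OF sym] by auto
  have "(?N$i$j)\<^sup>2 \<le> ?N$i$i * ?N$j$j" for i j
    using psd_Cauchy_Schwarz[OF N, of "axis i 1" "axis j 1"]
    by (simp add: matrix_vector_mul_component inner_axis' inner_axis)
  from this[of 1 2] this[of 1 3] this[of 2 3] show ?thesis
    unfolding norm_sq_Sym3[OF sym]
    by (simp add: mat_def s33 power2_eq_square) (simp add: algebra_simps)
qed

lemma cos_lode:
  assumes s0: "s \<noteq> 0"
  defines "c \<equiv> sqrt (3/2) * qmax s / norm s"
  shows "1/2 \<le> c" "c \<le> 1" "cos (lode s) = c"
proof -
  let ?r = "norm s"
  have r: "?r > 0" using s0 by simp
  have "(?r / 2)\<^sup>2 \<le> (sqrt (3/2) * qmax s)\<^sup>2"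
    using qmax_lower by (simp add: power_mult_distrib power_divide)
  then have "?r / 2 \<le> sqrt (3/2) * qmax s"
    by (rule power2_le_imp_le) (use qmax_nonneg in simp)
  then show c: "1/2 \<le> c" unfolding c_def using r by (simp add: field_simps)
  have "sqrt (3/2) * qmax s \<le> sqrt (3/2) * (sqrt (2/3) * ?r)"
    using qmax_upper by (intro mult_left_mono) auto
  also have "\<dots> = ?r" by (simp add: real_sqrt_mult[symmetric] mult.assoc[symmetric])
  finally show c1: "c \<le> 1" unfolding c_def using r by (simp add: field_simps)
  have J2: "J2 s = ?r\<^sup>2 / 2"
    unfolding J2_def devp_traceless[OF tr] by (simp add: frob_def power2_norm_eq_inner)
  have J2p: "J2 s powr (3/2) = (sqrt (J2 s)) ^ 3"
  proof -
    have "J2 s > 0" unfolding J2 using r by simp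
    then have "(sqrt (J2 s)) ^ 3 = (J2 s powr (1/2)) powr (real 3)"
      by (subst powr_realpow) (simp_all add: powr_half_sqrt)
    then show ?thesis by (simp add: powr_powr)
  qed
  have sq: "sqrt (J2 s) = ?r / sqrt 2" unfolding J2 using r by (simp add: real_sqrt_divide)
  \<comment> \<open>Normalising the characteristic equation by the norm turns it into the
    triple-angle polynomial.\<close>
  have "(3 * sqrt 3 / 2) * J3 s / (J2 s powr (3/2)) = 4 * c ^ 3 - 3 * c"
  proof -
    have s2: "sqrt 2 ^ 3 = 2 * sqrt (2::real)" and s3: "sqrt 3 ^ 3 = 3 * sqrt (3::real)"
      by (simp_all add: power3_eq_cube)
    have c': "c = sqrt 3 * qmax s / (sqrt 2 * ?r)"
      unfolding c_def by (simp add: real_sqrt_divide)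
    have J3: "J3 s = qmax s ^ 3 - ?r\<^sup>2 / 2 * qmax s" using qmax_root_charpoly by simp
    have "4 * c ^ 3 - 3 * c = 4 * (3 * sqrt 3 * qmax s ^ 3) / (2 * sqrt 2 * ?r ^ 3) - 3 * (sqrt 3 * qmax s / (sqrt 2 * ?r))"
      unfolding c' by (simp add: power_divide power_mult_distrib s2 s3)
    also have "\<dots> = (6 * sqrt 3 / (sqrt 2 * ?r ^ 3)) * J3 s"
      unfolding J3 using r by (simp add: field_simps power2_eq_square power3_eq_cube)
    also have "\<dots> = (3 * sqrt 3 / 2) * J3 s / (?r / sqrt 2) ^ 3"
    proof -
      have eq: "(?r / sqrt 2) ^ 3 = ?r ^ 3 / (2 * sqrt 2)" by (simp add: power_divide s2)
      show ?thesis unfolding eq using r by (simp add: divide_simps)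
    qed
    finally show ?thesis unfolding J2p sq ..
  qed
  also have "\<dots> = cos (3 * arccos c)"
    using c c1 by (simp add: cos_treble_cos)
  finally have x: "(3 * sqrt 3 / 2) * J3 s / (J2 s powr (3/2)) = cos (3 * arccos c)" .
  \<comment> \<open>The bound \<open>1/2 \<le> c\<close> keeps \<open>3 * arccos c\<close> in
    \<open>[0, pi]\<close>, where \<open>arccos\<close> undoes \<open>cos\<close>.\<close>
  have "arccos c \<le> arccos (1/2)" using c c1 by (intro arccos_le_arccos) auto
  moreover have "arccos (1/2) = pi / 3" using arccos_cos[of "pi / 3"] cos_60 by simp
  ultimately have "0 \<le> arccos c" "3 * arccos c \<le> pi" using arccos_lbound[of c] c c1 by auto
  then have "lode s = arccos c" unfolding lode_def x by (simp add: arccos_cos)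
  then show "cos (lode s) = c" using c c1 by simp
qed

end

section \<open>The elliptic radius as a homogeneous Lipschitz function\<close>

definition clampu :: "real \<Rightarrow> real" where "clampu c = max (1/2) (min 1 c)"

text \<open>The clamp is inactive on traceless symmetric matrices; elsewhere it keeps the argument of
  \<open>r_e\<close> away from the poles.\<close>

definition willam :: "real \<Rightarrow> mat3 \<Rightarrow> real" where
  "willam e s = norm s * r_e e (clampu (sqrt (3/2) * qmax s / norm s))"

lemma clampu_bounds: "1/2 \<le> clampu c" "clampu c \<le> 1"
  unfolding clampu_def by auto

lemma willam_zero: "willam e 0 = 0"
  unfolding willam_def by simp

lemma lode_devp: "lode (devp A) = lode A"
  unfolding lode_def J2_def J3_def devp_traceless[OF trace_devp] ..

lemma rho_e_eq_willam:
  assumes "A \<in> Sym3" shows "rho_e e A = willam e (devp A)"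
proof (cases "devp A = 0")
  case False
  show ?thesis
    using cos_lode[OF devp_in_Sym3[OF assms] trace_devp False] False
    unfolding rho_e_def willam_def rho_def clampu_def lode_devp by simp
qed (simp add: rho_e_def willam_def rho_def)

context
  fixes e :: real
  assumes e: "1/2 \<le> e" "e \<le> 1"
begin

text \<open>The difference of the two sides factors as
  \<open>(1 - e\<^sup>2) * (4 * c\<^sup>2 - 1)\<close>, which is where \<open>1/2 \<le> c\<close>
  enters.\<close>

lemma r_e_radicand:
  assumes "1/2 \<le> c" shows "(2*e - 1)\<^sup>2 \<le> 4 * (1 - e\<^sup>2) * c\<^sup>2 + 5 * e\<^sup>2 - 4 * e"
proof -
  have "e\<^sup>2 \<le> 1" using e by (simp add: power_le_one)
  moreover have "(1/2)\<^sup>2 \<le> c\<^sup>2" using assms by (intro power_mono) auto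
  ultimately have "0 \<le> (1 - e\<^sup>2) * (4 * c\<^sup>2 - 1)" by (simp add: power2_eq_square)
  also have "\<dots> = 4 * (1 - e\<^sup>2) * c\<^sup>2 + 5 * e\<^sup>2 - 4 * e - (2*e - 1)\<^sup>2"
    by (simp add: power2_eq_square algebra_simps)
  finally show ?thesis by simp
qed

lemma r_e_denominator_pos:
  assumes "1/2 \<le> c"
  shows "0 < 2 * (1 - e\<^sup>2) * c + (2*e - 1) * sqrt (4 * (1 - e\<^sup>2) * c\<^sup>2 + 5 * e\<^sup>2 - 4 * e)"
proof (cases "e = 1")
  case False
  then have "e\<^sup>2 < 1" using e by (simp add: power_strict_mono[of e 1 2, simplified] abs_square_less_1)
  then have "0 < 2 * (1 - e\<^sup>2) * c" using assms by simp
  moreover have "0 \<le> 4 * (1 - e\<^sup>2) * c\<^sup>2 + 5 * e\<^sup>2 - 4 * e"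
    using r_e_radicand[OF assms] by (meson order_trans zero_le_power2)
  ultimately show ?thesis using e by (simp add: add_pos_nonneg)
qed simp

lemma r_e_nonneg: "1/2 \<le> c \<Longrightarrow> 0 \<le> r_e e c"
  unfolding r_e_def using r_e_denominator_pos[of c] e
  by (intro divide_nonneg_pos) (auto simp: power_le_one)

text \<open>For \<open>e > 1/2\<close> the radicand is positive. At \<open>e = 1/2\<close> it
  vanishes for \<open>c = 1/2\<close>, but the factor \<open>2*e - 1\<close> removes the root and
  \<open>r_e\<close> reduces to \<open>2 * c\<close>.\<close>

lemma ssd_at_r_e:
  assumes c: "1/2 \<le> c"
  shows "ssd_at (r_e e) c"
proof (cases "e = 1/2")
  case True
  have "2 * y = r_e e y" if "y \<in> ball c (1/2)" for y
  proof -
    have "y > 0" using that c by (auto simp: dist_real_def abs_if split: if_splits)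
    then show ?thesis unfolding r_e_def True by (simp add: power2_eq_square)
  qed
  then show ?thesis
    using ssd_at_cong[of "\<lambda>y. 2 * y" c "1/2" "r_e e"] 
      ssd_at_mult[OF ssd_at_const ssd_at_ident, of 2 c] by simp
next
  case False
  then have "0 < (2*e - 1)\<^sup>2" using e by simp
  then have "0 < 4 * (1 - e\<^sup>2) * c\<^sup>2 + 5 * e\<^sup>2 - 4 * e" using r_e_radicand[OF c] by linarith
  then show ?thesis
    unfolding r_e_def[abs_def] using r_e_denominator_pos[OF c]
    by (intro ssd_at_divide ssd_at_add ssd_at_diff ssd_at_mult ssd_at_sqrt ssd_at_power2
        ssd_at_const ssd_at_ident) auto
qed

lemma r_e_lipschitz:
  obtains L where "L-lipschitz_on {1/2..1} (r_e e)"
proof -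
  \<comment> \<open>The one-point time set adapts a statement about time-dependent maps: locally
    Lipschitz on a compact set implies Lipschitz.\<close>
  have "local_lipschitz {0::real} {1/2..1} (\<lambda>_. r_e e)"
  proof (rule local_lipschitzI)
    fix t c :: real assume "c \<in> {1/2..1}"
    then have "ssd_at (r_e e) c" by (intro ssd_at_r_e) simp
    then obtain r L C where r: "r > 0" "L-lipschitz_on (ball c r) (r_e e)" by (rule ssd_atE)
    then have "L-lipschitz_on (cball c (r/2) \<inter> {1/2..1}) (r_e e)"
      by (auto intro: lipschitz_on_subset)
    with r show "\<exists>u>0. \<exists>L. \<forall>t\<in>cball t u \<inter> {0}. L-lipschitz_on (cball c u \<inter> {1/2..1}) (r_e e)"
      by (intro exI[of _ "r/2"]) auto
  qed
  then show ?thesis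
    using local_lipschitz_compact_implies_lipschitz[where X = "{1/2..1}" and T = "{0::real}"
        and f = "\<lambda>_. r_e e"] that
    by (auto intro: compact_Icc)
qed

lemma willam_nonneg: "0 \<le> willam e s"
  unfolding willam_def by (intro mult_nonneg_nonneg r_e_nonneg clampu_bounds) simp

lemma willam_homogeneous: "t > 0 \<Longrightarrow> willam e (t *\<^sub>R s) = t * willam e s"
  unfolding willam_def by (simp add: qmax_scaleR)

lemma ssd_at_willam:
  assumes "s \<noteq> 0" shows "ssd_at (willam e) s"
  unfolding willam_def[abs_def]
proof (rule ssd_at_mult[OF ssd_at_norm[OF ssd_at_ident] ssd_at_compose[where G = "r_e e"]])
  show "ssd_at (r_e e) (clampu (sqrt (3/2) * qmax s / norm s))"
    by (intro ssd_at_r_e clampu_bounds)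
  show "ssd_at (\<lambda>s. clampu (sqrt (3/2) * qmax s / norm s)) s"
    unfolding clampu_def using assms
    by (intro ssd_at_max ssd_at_min ssd_at_const ssd_at_divide ssd_at_mult ssd_at_qmax ssd_at_norm ssd_at_ident)
      auto
qed

text \<open>The ratio \<open>qmax s / norm s\<close> is not Lipschitz near \<open>0\<close>, but its
  increments are once multiplied by \<open>norm s'\<close>, and that weight is available in the
  product.\<close>

lemma willam_lipschitz:
  obtains L where "L-lipschitz_on UNIV (willam e)"
proof -
  obtain L where L: "L-lipschitz_on {1/2..1} (r_e e)" by (rule r_e_lipschitz)
  have L0: "L \<ge> 0" using L lipschitz_on_nonneg by auto
  define k where "k = (\<lambda>c. r_e e (clampu c))"
  have k: "\<bar>k c - k c'\<bar> \<le> L * \<bar>c - c'\<bar>" for c c'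
  proof -
    have "\<bar>k c - k c'\<bar> \<le> L * \<bar>clampu c - clampu c'\<bar>"
      using lipschitz_onD[OF L, of "clampu c" "clampu c'"] clampu_bounds
      unfolding k_def by (simp add: dist_real_def)
    also have "\<dots> \<le> L * \<bar>c - c'\<bar>"
      using L0 by (intro mult_left_mono) (auto simp: clampu_def max_def min_def)
    finally show ?thesis .
  qed
  define B where "B = \<bar>r_e e 1\<bar> + L"
  have B0: "B \<ge> 0" unfolding B_def using L0 by simp
  have B: "\<bar>k c\<bar> \<le> B" for c
  proof -
    have "\<bar>k c - r_e e 1\<bar> \<le> L * \<bar>clampu c - 1\<bar>"
      using lipschitz_onD[OF L, of "clampu c" 1] clampu_bounds[of c]
      unfolding k_def by (simp add: dist_real_def)
    also have "\<dots> \<le> L * 1" using clampu_bounds[of c] L0 by (intro mult_left_mono) auto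
    finally show ?thesis unfolding B_def by linarith
  qed
  let ?a = "sqrt (3/2) :: real"
  have a: "0 \<le> ?a" "?a \<le> 2" by (auto intro: real_le_lsqrt)
  have w: "willam e s = norm s * k (?a * qmax s / norm s)" for s
    unfolding willam_def k_def ..
  have wb: "\<bar>willam e s\<bar> \<le> B * norm s" for s
    using mult_left_mono[OF B[of "?a * qmax s / norm s"] norm_ge_zero[of s]] unfolding w
    by (simp add: abs_mult mult.commute)
  have "(B + 4 * L)-lipschitz_on UNIV (willam e)"
  proof (rule lipschitz_onI)
    fix s s' :: mat3
    show "dist (willam e s) (willam e s') \<le> (B + 4 * L) * dist s s'"
    proof (cases "s = 0 \<or> s' = 0")
      case True
      then have "dist (willam e s) (willam e s') \<le> B * dist s s'"
        using wb[of s] wb[of s'] by (auto simp: willam_zero dist_real_def)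
      also have "\<dots> \<le> (B + 4 * L) * dist s s'" using L0 by (simp add: mult_right_mono)
      finally show ?thesis .
    next
      case False
      then have n: "norm s > 0" "norm s' > 0" by auto
      let ?t = "?a * qmax s / norm s" and ?t' = "?a * qmax s' / norm s'"
      have t: "\<bar>?t\<bar> \<le> 2"
      proof -
        have "\<bar>?t\<bar> = ?a * (\<bar>qmax s\<bar> / norm s)" by (simp add: abs_mult)
        also have "\<dots> \<le> 2 * 1" using a n abs_qmax_le[of s] by (intro mult_mono) auto
        finally show ?thesis by simp
      qed
      have dn: "\<bar>norm s - norm s'\<bar> \<le> dist s s'" by (simp add: dist_norm norm_triangle_ineq3)
      have dq: "\<bar>qmax s - qmax s'\<bar> \<le> dist s s'"
        using lipschitz_onD[OF lipschitz_on_qmax, of s s'] by (simp add: dist_real_def)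
      have "norm s' * \<bar>?t - ?t'\<bar> = \<bar>norm s' * (?t - ?t')\<bar>" by (simp add: abs_mult)
      \<comment> \<open>Both coefficients on the right, \<open>?t\<close> and \<open>?a\<close>, are
        at most 2 in absolute value, which yields the factor 4.\<close>
      also have "norm s' * (?t - ?t') = (norm s' - norm s) * ?t + ?a * (qmax s - qmax s')"
        using n by (simp add: field_simps)
      also have "\<bar>\<dots>\<bar> \<le> \<bar>norm s' - norm s\<bar> * \<bar>?t\<bar> + ?a * \<bar>qmax s - qmax s'\<bar>"
        using abs_triangle_ineq[of "(norm s' - norm s) * ?t" "?a * (qmax s - qmax s')"]
        by (simp add: abs_mult)
      also have "\<dots> \<le> dist s s' * 2 + 2 * dist s s'"
        using dn dq t a by (intro add_mono mult_mono) (auto simp: abs_minus_commute)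
      finally have d: "norm s' * \<bar>?t - ?t'\<bar> \<le> 4 * dist s s'" by simp
      have "\<bar>willam e s - willam e s'\<bar> = \<bar>(norm s - norm s') * k ?t + norm s' * (k ?t - k ?t')\<bar>"
        unfolding w by (simp add: algebra_simps)
      also have "\<dots> \<le> \<bar>norm s - norm s'\<bar> * \<bar>k ?t\<bar> + norm s' * \<bar>k ?t - k ?t'\<bar>"
        using abs_triangle_ineq[of "(norm s - norm s') * k ?t" "norm s' * (k ?t - k ?t')"]
        by (simp add: abs_mult)
      also have "\<dots> \<le> dist s s' * B + norm s' * (L * \<bar>?t - ?t'\<bar>)"
        using dn B k by (intro add_mono mult_mono) auto
      also have "\<dots> \<le> dist s s' * B + L * (4 * dist s s')"
        using mult_left_mono[OF d L0] by (simp add: ac_simps)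
      finally show ?thesis by (simp add: dist_real_def algebra_simps)
    qed
  qed (use B0 L0 in simp)
  then show ?thesis by (rule that)
qed

end

section \<open>The return mapping\<close>

lemma Sym3_closed:
  "A \<in> Sym3 \<Longrightarrow> B \<in> Sym3 \<Longrightarrow> A + B \<in> Sym3"
  "A \<in> Sym3 \<Longrightarrow> B \<in> Sym3 \<Longrightarrow> A - B \<in> Sym3"
  "A \<in> Sym3 \<Longrightarrow> c *\<^sub>R A \<in> Sym3"
  "Id3 \<in> Sym3" "0 \<in> Sym3"
  by (auto simp: Sym3_entries mat3_expand)

lemma subspace_Sym3: "subspace Sym3"
  by (simp add: subspace_def Sym3_closed)

lemma De_in_Sym3: "A \<in> Sym3 \<Longrightarrow> De K G A \<in> Sym3"
  unfolding De_def by (intro Sym3_closed devp_in_Sym3)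

lemma pres_linear: "pres (A + B) = pres A + pres B" "pres (A - B) = pres A - pres B"
  "pres (c *\<^sub>R A) = c * pres A"
  by (simp_all add: pres_def frob_def inner_add_right inner_diff_right)

lemma devp_eq: "devp A = A - pres A *\<^sub>R Id3"
  by (simp add: devp_def pres_def)

lemma devp_linear: "devp (A + B) = devp A + devp B" "devp (A - B) = devp A - devp B"
  "devp (c *\<^sub>R A) = c *\<^sub>R devp A"
  by (simp_all add: devp_eq pres_linear algebra_simps)

lemma pres_devp: "pres (devp A) = 0"
  unfolding pres_def by (simp add: trace_devp)

lemma pres_Id3: "pres Id3 = 1"
  by (simp add: pres_def mat3_expand)

lemma devp_Id3: "devp Id3 = 0"
  by (simp add: devp_eq pres_Id3)

lemma pres_devp_split: "pres A *\<^sub>R Id3 + devp A = A"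
  by (simp add: devp_eq)

lemma subdiff_rho_pres: "n \<in> subdiff_rho \<sigma> \<Longrightarrow> pres n = 0"
  by (cases "rho \<sigma> > 0") (simp_all add: subdiff_rho_def pres_linear pres_devp, simp add: pres_def)

lemma subdiff_rho_devp: "n \<in> subdiff_rho \<sigma> \<Longrightarrow> devp n = n"
  using subdiff_rho_pres by (simp add: devp_eq)

lemma ssd_at_pres:
  fixes F :: "'a::real_normed_vector \<Rightarrow> mat3"
  shows "ssd_at F x \<Longrightarrow> ssd_at (\<lambda>x. pres (F x)) x"
  unfolding pres_def frob_def by (intro ssd_at_mult ssd_at_inner ssd_at_const)

lemma ssd_at_devp:
  fixes F :: "'a::real_normed_vector \<Rightarrow> mat3"
  shows "ssd_at F x \<Longrightarrow> ssd_at (\<lambda>x. devp (F x)) x"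
  unfolding devp_eq by (intro ssd_at_diff ssd_at_scaleR ssd_at_pres ssd_at_const)

lemma ssd_at_De:
  fixes F :: "'a::real_normed_vector \<Rightarrow> mat3"
  shows "ssd_at F x \<Longrightarrow> ssd_at (\<lambda>x. De K G (F x)) x"
  unfolding De_def frob_def
  by (intro ssd_at_add ssd_at_scaleR ssd_at_mult ssd_at_inner ssd_at_devp ssd_at_const)

lemma ssd_at_soft_compose:
  fixes w :: "'a::real_inner \<Rightarrow> 'b::real_normed_vector" and F :: "'c::real_normed_vector \<Rightarrow> 'a"
  assumes "\<And>z. ssd_at (soft w) z" "ssd_at F x" "ssd_at a x"
  shows "ssd_at (\<lambda>x. soft w (F x, a x)) x"
  by (rule ssd_at_compose[where F = "\<lambda>x. (F x, a x)", OF assms(1) ssd_at_Pair[OF assms(2,3)]])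

lemma willam_scale: "1/2 \<le> e \<Longrightarrow> e \<le> 1 \<Longrightarrow> 0 \<le> t \<Longrightarrow> willam e (t *\<^sub>R s) = t * willam e s"
  using willam_homogeneous[of e t s] willam_zero[of e] by (cases "t = 0") auto

section \<open>Reduction of the return system to a scalar equation\<close>

locale return_mapping =
  fixes K G m0 Ag Bg fc ft e :: real
  assumes pos: "K > 0" "G > 0" "m0 > 0" "Ag > 0" "Bg > 0" "fc > 0"
    and e: "1/2 \<le> e" "e \<le> 1"
begin

text \<open>The volumetric equation gives \<open>\<triangle>\<lambda>\<close> explicitly in terms of the unknown pressure \<open>p\<close>; the maximum
  extends it by \<open>0\<close> beyond the trial pressure.\<close>

definition plastic_mult :: "real \<Rightarrow> mat3 \<Rightarrow> real" where
  "plastic_mult p u = fc / (K * Ag) * max 0 (pres u - p) * exp ((ft/3 - p) / (Bg * fc))"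

text \<open>The deviatoric flow has a constant part and a part proportional to \<open>rho\<close>.
  The constant part is \<open>thresh\<close>; moving the other to the left leaves
  \<open>denom\<close> as the factor of \<open>rho\<close>, so \<open>rho * denom\<close> is the
  trial norm minus \<open>thresh\<close> when positive.\<close>

definition thresh :: "real \<Rightarrow> mat3 \<Rightarrow> real" where
  "thresh p u = 2 * G * (m0 / (sqrt 6 * fc)) * plastic_mult p u"

definition denom :: "real \<Rightarrow> mat3 \<Rightarrow> real" where
  "denom p u = 1 + 6 * G / fc\<^sup>2 * plastic_mult p u"

definition ret :: "mat3 \<Rightarrow> real \<Rightarrow> mat3" where
  "ret u p = p *\<^sub>R Id3 + (1 / denom p u) *\<^sub>R soft (\<lambda>s. s) (devp u, thresh p u)"

text \<open>This is the yield function along the candidates \<open>ret u p\<close>, expressed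
  through \<open>soft\<close> so that it is semismooth for every \<open>u\<close>; the agreement for
  symmetric \<open>u\<close> is \<open>fhat_ret\<close>.\<close>

definition yield :: "real \<times> mat3 \<Rightarrow> real" where
  "yield z = (let p = fst z; u = snd z in
     fhat m0 fc p (max 0 (norm (devp u) - thresh p u) / denom p u)
       (soft (willam e) (devp u, thresh p u) / denom p u))"

lemma plastic_mult_nonneg: "0 \<le> plastic_mult p u"
  unfolding plastic_mult_def using pos by simp

lemma thresh_nonneg: "0 \<le> thresh p u"
  unfolding thresh_def using pos plastic_mult_nonneg by simp

lemma denom_ge_1: "1 \<le> denom p u"
  unfolding denom_def using pos plastic_mult_nonneg by simp

lemma plastic_mult_flow: "plastic_mult p u * (K * mg' Ag Bg fc ft p / fc) = max 0 (pres u - p)"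
proof -
  have "exp ((ft/3 - p) / (Bg * fc)) * exp ((p - ft/3) / (Bg * fc)) = 1"
    by (simp add: exp_add[symmetric] add_divide_distrib[symmetric])
  then show ?thesis unfolding plastic_mult_def mg'_def using pos by (simp add: field_simps)
qed

lemma plastic_mult_antimono: "a \<le> b \<Longrightarrow> plastic_mult b u \<le> plastic_mult a u"
  unfolding plastic_mult_def using pos by (intro mult_mono) (auto intro!: divide_right_mono)

lemma thresh_antimono: "a \<le> b \<Longrightarrow> thresh b u \<le> thresh a u"
  unfolding thresh_def using plastic_mult_antimono pos by (intro mult_left_mono) auto

lemma denom_antimono: "a \<le> b \<Longrightarrow> denom b u \<le> denom a u"
  unfolding denom_def using plastic_mult_antimono[of a b u] pos by (auto intro!: mult_left_mono divide_right_mono)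

text \<open>The two deviatoric terms are merely nondecreasing, as numerators grow and denominators
  shrink; the slope comes from the linear pressure term.\<close>

lemma yield_strongly_mono:
  assumes ab: "a \<le> b"
  shows "m0 / fc * (b - a) \<le> yield (b, u) - yield (a, u)"
proof -
  let ?m = "\<lambda>p. max 0 (norm (devp u) - thresh p u)"
  have m: "?m a \<le> ?m b" using thresh_antimono[OF ab, of u] by auto
  have d: "denom b u \<le> denom a u" "0 < denom b u"
    using denom_antimono[OF ab] denom_ge_1[of b u] by auto
  have r: "?m a / denom a u \<le> ?m b / denom b u" using m d by (intro frac_le) auto
  have "soft (willam e) (devp u, thresh p u) = ?m p * (willam e (devp u) / norm (devp u))" for p
    using thresh_nonneg[of p u] by (simp add: soft_def max.absorb2)
  moreover have "?m a * (willam e (devp u) / norm (devp u)) \<le> ?m b * (willam e (devp u) / norm (devp u))"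
    using m willam_nonneg[OF e] by (intro mult_right_mono) auto
  ultimately have s: "soft (willam e) (devp u, thresh a u) / denom a u
      \<le> soft (willam e) (devp u, thresh b u) / denom b u"
    using d willam_nonneg[OF e, of "devp u"] by (intro frac_le) auto
  have "(?m a / denom a u / fc)\<^sup>2 \<le> (?m b / denom b u / fc)\<^sup>2"
    using r pos denom_ge_1[of a u] by (intro power_mono divide_right_mono) auto
  moreover have "m0 * (soft (willam e) (devp u, thresh a u) / denom a u / (sqrt 6 * fc))
      \<le> m0 * (soft (willam e) (devp u, thresh b u) / denom b u / (sqrt 6 * fc))"
    using s pos by (intro mult_left_mono divide_right_mono) auto
  moreover have "m0 / fc * (b - a) = m0 * (b / fc) - m0 * (a / fc)"
    by (simp add: right_diff_distrib)
  ultimately show ?thesis unfolding yield_def fhat_def by (simp add: distrib_left)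
qed

lemma ssd_at_soft_id: "ssd_at (soft (\<lambda>s::mat3. s)) z"
  by (rule ssd_at_soft[where L = 1]) (auto intro: lipschitz_onI ssd_at_ident)

lemma ssd_at_soft_willam: "ssd_at (soft (willam e)) z"
proof -
  obtain L where "L-lipschitz_on UNIV (willam e)" using willam_lipschitz[OF e] .
  then show ?thesis
    by (rule ssd_at_soft[rotated]) (use willam_homogeneous[OF e] ssd_at_willam[OF e] in auto)
qed

lemma ssd_at_plastic_mult:
  fixes P :: "'a::real_normed_vector \<Rightarrow> real" and U :: "'a \<Rightarrow> mat3"
  assumes "ssd_at P x" "ssd_at U x"
  shows "ssd_at (\<lambda>x. plastic_mult (P x) (U x)) x"
  unfolding plastic_mult_def using assms pos
  by (intro ssd_at_mult ssd_at_const ssd_at_max ssd_at_diff ssd_at_pres ssd_at_exp ssd_at_divide) auto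

lemma ssd_at_thresh:
  fixes P :: "'a::real_normed_vector \<Rightarrow> real" and U :: "'a \<Rightarrow> mat3"
  assumes "ssd_at P x" "ssd_at U x"
  shows "ssd_at (\<lambda>x. thresh (P x) (U x)) x"
  unfolding thresh_def using assms by (intro ssd_at_mult ssd_at_const ssd_at_plastic_mult)

lemma ssd_at_denom:
  fixes P :: "'a::real_normed_vector \<Rightarrow> real" and U :: "'a \<Rightarrow> mat3"
  assumes "ssd_at P x" "ssd_at U x"
  shows "ssd_at (\<lambda>x. denom (P x) (U x)) x"
  unfolding denom_def using assms by (intro ssd_at_add ssd_at_mult ssd_at_const ssd_at_plastic_mult)

lemma denom_nonzero: "denom p u \<noteq> 0"
  using denom_ge_1[of p u] by simp

lemma ssd_at_yield: "ssd_at yield z"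
  unfolding yield_def[abs_def] fhat_def Let_def using pos denom_nonzero
  by (intro ssd_at_add ssd_at_diff ssd_at_mult ssd_at_const ssd_at_power2 ssd_at_divide ssd_at_max
      ssd_at_norm ssd_at_devp ssd_at_thresh ssd_at_denom ssd_at_fst ssd_at_snd ssd_at_ident
      ssd_at_soft_compose ssd_at_soft_willam) auto

lemma ssd_at_ret:
  fixes P :: "'a::real_normed_vector \<Rightarrow> real" and U :: "'a \<Rightarrow> mat3"
  assumes "ssd_at P x" "ssd_at U x"
  shows "ssd_at (\<lambda>x. ret (U x) (P x)) x"
  unfolding ret_def using assms denom_nonzero
  by (intro ssd_at_add ssd_at_scaleR ssd_at_const ssd_at_divide ssd_at_denom ssd_at_soft_compose
      ssd_at_soft_id ssd_at_devp ssd_at_thresh) auto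

definition pstar :: "mat3 \<Rightarrow> real" where
  "pstar u = (SOME p. yield (p, u) = 0)"

lemma yield_pstar: "yield (pstar u, u) = 0"
proof -
  have "isCont (\<lambda>p. yield (p, u)) p" for p
    by (intro ssd_at_isCont ssd_at_compose[OF ssd_at_yield] ssd_at_Pair ssd_at_ident ssd_at_const)
  then have "continuous_on UNIV (\<lambda>p. yield (p, u))"
    by (simp add: continuous_at_imp_continuous_on)
  then have "\<exists>p. yield (p, u) = 0"
    using strongly_mono_root[of "\<lambda>p. yield (p, u)" "m0 / fc"] yield_strongly_mono pos by simp
  then show ?thesis unfolding pstar_def by (rule someI_ex)
qed

lemma ssd_at_pstar: "ssd_at pstar u"
  by (rule ssd_at_implicit[of yield "m0 / fc"])
    (use ssd_at_yield yield_strongly_mono yield_pstar pos in auto)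

lemma yield_eq_0_iff: "yield (p, u) = 0 \<longleftrightarrow> p = pstar u"
proof
  have mu: "0 < m0 / fc" using pos by simp
  assume p: "yield (p, u) = 0"
  show "p = pstar u"
  proof (cases "p \<le> pstar u")
    case True
    then have "\<not> 0 < m0 / fc * (pstar u - p)"
      using yield_strongly_mono[of p "pstar u" u] p yield_pstar by simp
    with True mult_pos_pos[OF mu, of "pstar u - p"] show ?thesis by linarith
  next
    case False
    then have "\<not> 0 < m0 / fc * (p - pstar u)"
      using yield_strongly_mono[of "pstar u" p u] p yield_pstar by simp
    with False mult_pos_pos[OF mu, of "p - pstar u"] show ?thesis by linarith
  qed
qed (simp add: yield_pstar)

lemma yield_mono: "a \<le> b \<Longrightarrow> yield (a, u) \<le> yield (b, u)"
  using yield_strongly_mono[of a b u] pos by (smt (verit) divide_nonneg_pos mult_nonneg_nonneg)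

lemma ret_scaled_devp:
  "ret u p = p *\<^sub>R Id3 + (max 0 (norm (devp u) - thresh p u) / (denom p u * norm (devp u))) *\<^sub>R devp u"
  unfolding ret_def soft_def using thresh_nonneg[of p u] by (simp add: max.absorb2)

lemma pres_ret: "pres (ret u p) = p"
  unfolding ret_scaled_devp by (simp add: pres_linear pres_Id3 pres_devp)

lemma devp_ret:
  "devp (ret u p) = (max 0 (norm (devp u) - thresh p u) / (denom p u * norm (devp u))) *\<^sub>R devp u"
  unfolding ret_scaled_devp by (simp add: devp_linear devp_Id3 devp_traceless[OF trace_devp])

lemma rho_ret: "rho (ret u p) = max 0 (norm (devp u) - thresh p u) / denom p u"
  unfolding rho_def devp_ret using denom_ge_1[of p u] thresh_nonneg[of p u] by (auto simp: max_def)

lemma ret_in_Sym3: "u \<in> Sym3 \<Longrightarrow> ret u p \<in> Sym3"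
  unfolding ret_scaled_devp by (intro Sym3_closed devp_in_Sym3)

text \<open>\<open>ret\<close> multiplies the trial deviator by a nonnegative factor, so the
  homogeneity of \<open>willam\<close> evaluates \<open>rho_e\<close>.\<close>

lemma fhat_ret:
  assumes u: "u \<in> Sym3"
  shows "fhat m0 fc (pres (ret u p)) (rho (ret u p)) (rho_e e (ret u p)) = yield (p, u)"
proof -
  have "rho_e e (ret u p) = soft (willam e) (devp u, thresh p u) / denom p u"
    unfolding rho_e_eq_willam[OF ret_in_Sym3[OF u]] devp_ret
    using denom_ge_1[of p u] thresh_nonneg[of p u]
    by (subst willam_scale[OF e]) (auto simp: soft_def max.absorb2)
  then show ?thesis unfolding pres_ret rho_ret yield_def by simp
qed

lemma ret_trial:
  assumes "pres u \<le> p" shows "ret u p = p *\<^sub>R Id3 + devp u"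
proof -
  have "plastic_mult p u = 0" unfolding plastic_mult_def using assms by simp
  then show ?thesis unfolding ret_scaled_devp thresh_def denom_def by (simp add: max.absorb2)
qed

lemma ret_pres: "ret u (pres u) = u"
  by (simp add: ret_trial pres_devp_split)

lemma flow_factor:
  "plastic_mult p u * (2 * G * (3 * r / fc\<^sup>2 + m0 / (sqrt 6 * fc))) = r * (denom p u - 1) + thresh p u"
  unfolding denom_def thresh_def by (simp add: algebra_simps)

section \<open>Existence and uniqueness of the plastic return\<close>

text \<open>Existence for the plastic case. Off the apex the flow direction is the unit trial
  deviator; at the apex it is the trial deviator divided by the threshold.\<close>

lemma return_system_ret:
  assumes u: "u \<in> Sym3" and p: "p < pres u" "yield (p, u) = 0"
  shows "return_system K G m0 Ag Bg fc ft e u (ret u p) (plastic_mult p u)"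
proof -
  let ?r = "rho (ret u p)" and ?s = "devp u" and ?th = "thresh p u"
  let ?c = "K * mg' Ag Bg fc ft (pres (ret u p)) / fc"
  let ?f = "2 * G * (3 * ?r / fc\<^sup>2 + m0 / (sqrt 6 * fc))"
  have l0: "plastic_mult p u > 0" unfolding plastic_mult_def using pos p(1) by simp
  have th0: "?th > 0" unfolding thresh_def using l0 pos by simp
  have lc: "plastic_mult p u * ?c = pres u - p" unfolding pres_ret plastic_mult_flow using p(1) by simp
  have lf: "plastic_mult p u * ?f = ?r * (denom p u - 1) + ?th" by (rule flow_factor)
  have "\<exists>n\<in>subdiff_rho (ret u p). devp (ret u p) = ?s - (plastic_mult p u * ?f) *\<^sub>R n"
  proof (cases "?r > 0")
    case True
    have "norm ?s > ?th"
    proof (rule ccontr)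
      assume "\<not> norm ?s > ?th"
      with True show False unfolding rho_ret by (simp add: max.absorb1)
    qed
    then have m: "max 0 (norm ?s - ?th) = norm ?s - ?th" "norm ?s > ?th" by auto
    have rd: "?r * denom p u = norm ?s - ?th" unfolding rho_ret m using denom_nonzero by simp
    have d: "devp (ret u p) = (?r / norm ?s) *\<^sub>R ?s"
      unfolding devp_ret rho_ret by simp
    let ?n = "(1 / ?r) *\<^sub>R devp (ret u p)"
    have n: "?n = (1 / norm ?s) *\<^sub>R ?s" unfolding d using True by simp
    have "?s - (plastic_mult p u * ?f) *\<^sub>R ?n = (1 - (norm ?s - ?r) / norm ?s) *\<^sub>R ?s"
    proof -
      have "?r * (denom p u - 1) + ?th = norm ?s - ?r" using rd by (simp add: algebra_simps)
      then show ?thesis unfolding n lf by (simp add: scaleR_diff_left)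
    qed
    also have "1 - (norm ?s - ?r) / norm ?s = ?r / norm ?s"
    proof -
      have "norm ?s \<noteq> 0" using m th0 by linarith
      then show ?thesis by (simp add: diff_divide_distrib)
    qed
    finally have "devp (ret u p) = ?s - (plastic_mult p u * ?f) *\<^sub>R ?n" unfolding d ..
    moreover have "?n \<in> subdiff_rho (ret u p)" using True by (simp add: subdiff_rho_def)
    ultimately show ?thesis by blast
  next
    case False
    then have r: "?r = 0" unfolding rho_def by simp
    then have d: "devp (ret u p) = 0" unfolding rho_def by simp
    \<comment> \<open>Return to the apex means that the threshold dominates the trial deviator, so
      \<open>(1 / ?th) *\<^sub>R ?s\<close> has norm at most 1 and is an admissible flow
      direction.\<close>
    have "norm ?s \<le> ?th" using r denom_nonzero[of p u] unfolding rho_ret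
      by (auto simp: max_def split: if_splits)
    moreover have "Id3 :\<^sub>F ((1 / ?th) *\<^sub>R ?s) = 0"
      using trace_devp[of u] by (simp add: frob_def)
    ultimately have "(1 / ?th) *\<^sub>R ?s \<in> subdiff_rho (ret u p)"
      using r th0 u unfolding subdiff_rho_def by (simp add: Sym3_closed devp_in_Sym3)
    moreover have "devp (ret u p) = ?s - (plastic_mult p u * ?f) *\<^sub>R ((1 / ?th) *\<^sub>R ?s)"
      unfolding d lf unfolding r using th0 by simp
    ultimately show ?thesis by blast
  qed
  then obtain n where n: "n \<in> subdiff_rho (ret u p)" and d: "devp (ret u p) = ?s - (plastic_mult p u * ?f) *\<^sub>R n"
    by blast
  have "u - plastic_mult p u *\<^sub>R (?c *\<^sub>R Id3 + ?f *\<^sub>R n) = (pres u *\<^sub>R Id3 + ?s) - (plastic_mult p u * ?c) *\<^sub>R Id3 - (plastic_mult p u * ?f) *\<^sub>R n"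
    unfolding pres_devp_split by (simp add: algebra_simps)
  also have "\<dots> = p *\<^sub>R Id3 + devp (ret u p)" unfolding lc d by (simp add: algebra_simps)
  also have "\<dots> = ret u p" using pres_devp_split[of "ret u p"] by (simp add: pres_ret)
  finally have "ret u p = u - plastic_mult p u *\<^sub>R (?c *\<^sub>R Id3 + ?f *\<^sub>R n)" ..
  with n show ?thesis
    unfolding return_system_def fhat_ret[OF u] p(2) using ret_in_Sym3[OF u] plastic_mult_nonneg by auto
qed

text \<open>Elements of \<open>subdiff_rho\<close> are deviatoric, so \<open>pres\<close> and
  \<open>devp\<close> decouple the flow rule. The pressure part determines \<open>l\<close>. The
  deviatoric part makes \<open>devp \<sigma>\<close> a multiple of the trial deviator, or at the
  apex forces its norm below the threshold.\<close>

lemma return_system_imp_ret: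
  assumes u: "u \<in> Sym3" and sys: "return_system K G m0 Ag Bg fc ft e u \<sigma> l"
  shows "\<sigma> = ret u (pres \<sigma>)" "l = plastic_mult (pres \<sigma>) u" "pres \<sigma> \<le> pres u"
proof -
  let ?p = "pres \<sigma>" and ?r = "rho \<sigma>" and ?s = "devp u"
  let ?c = "K * mg' Ag Bg fc ft ?p / fc"
  let ?f = "2 * G * (3 * ?r / fc\<^sup>2 + m0 / (sqrt 6 * fc))"
  from sys obtain n where n: "n \<in> subdiff_rho \<sigma>"
    and eq: "\<sigma> = u - l *\<^sub>R (?c *\<^sub>R Id3 + ?f *\<^sub>R n)" and l: "l \<ge> 0"
    unfolding return_system_def by blast
  have c: "?c > 0" unfolding mg'_def using pos by simp
  have pe: "?p = pres u - l * ?c"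
    using arg_cong[OF eq, of pres] by (simp add: pres_linear pres_Id3 subdiff_rho_pres[OF n])
  have de: "devp \<sigma> = ?s - (l * ?f) *\<^sub>R n"
    using arg_cong[OF eq, of devp] by (simp add: devp_linear devp_Id3 subdiff_rho_devp[OF n])
  have "0 \<le> l * ?c" using l c by (intro mult_nonneg_nonneg) auto
  with pe show p: "?p \<le> pres u" by simp
  have "l * ?c = plastic_mult ?p u * ?c" unfolding plastic_mult_flow using pe p by simp
  then show lm: "l = plastic_mult ?p u" using c by (auto simp only: mult_cancel_right)
  let ?th = "thresh ?p u" and ?d = "denom ?p u"
  have lf: "l * ?f = ?r * (?d - 1) + ?th" unfolding lm by (rule flow_factor)
  have "devp \<sigma> = (max 0 (norm ?s - ?th) / (?d * norm ?s)) *\<^sub>R ?s"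
  proof (cases "?r > 0")
    case True
    let ?a = "?r * (?d - 1) + ?th"
    have a: "0 \<le> ?a" using True denom_ge_1 thresh_nonneg by simp
    have "n = (1 / ?r) *\<^sub>R devp \<sigma>" using n True by (simp add: subdiff_rho_def)
    with de have "devp \<sigma> = ?s - ?a *\<^sub>R ((1 / ?r) *\<^sub>R devp \<sigma>)" unfolding lf by metis
    then have "?s = devp \<sigma> + ?a *\<^sub>R ((1 / ?r) *\<^sub>R devp \<sigma>)" by (metis diff_add_cancel)
    then have "?s = (1 + ?a / ?r) *\<^sub>R devp \<sigma>"
      by (simp only: scaleR_scaleR scaleR_add_left scaleR_one times_divide_eq_right mult_1_right)
    then have s: "?s = ((?r + ?a) / ?r) *\<^sub>R devp \<sigma>" using True by (simp add: add_divide_distrib)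
    then have "norm ?s = (?r + ?a) / ?r * ?r"
      using a True by (simp add: rho_def[symmetric] abs_of_nonneg)
    then have ns: "norm ?s = ?r + ?a" using True by simp
    have "devp \<sigma> = (?r / norm ?s) *\<^sub>R ?s" using s ns True a by simp
    moreover have "norm ?s - ?th = ?r * ?d" using ns by (simp add: algebra_simps)
    ultimately show ?thesis using True denom_ge_1[of ?p u] by simp
  next
    case False
    then have r: "?r = 0" unfolding rho_def by simp
    then have d0: "devp \<sigma> = 0" unfolding rho_def by simp
    have "norm n \<le> 1" using n r by (simp add: subdiff_rho_def)
    moreover have "?s = ?th *\<^sub>R n" using de d0 unfolding lf unfolding r by simp
    ultimately have "norm ?s \<le> ?th" using thresh_nonneg[of ?p u] by (simp add: mult_left_le)
    then show ?thesis using d0 by simp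
  qed
  then show "\<sigma> = ret u ?p"
    using pres_devp_split[of \<sigma>] unfolding ret_scaled_devp by simp
qed

lemma return_system_unique:
  assumes u: "u \<in> Sym3" and f: "fhat m0 fc (pres u) (rho u) (rho_e e u) > 0"
    and sys: "return_system K G m0 Ag Bg fc ft e u \<sigma> l"
  shows "\<sigma> = ret u (pstar u) \<and> l = plastic_mult (pstar u) u"
proof -
  note s = return_system_imp_ret[OF u sys]
  have fy: "fhat m0 fc (pres \<sigma>) (rho \<sigma>) (rho_e e \<sigma>) = yield (pres \<sigma>, u)"
    using fhat_ret[OF u, of "pres \<sigma>"] s(1) by simp
  have y: "yield (pres \<sigma>, u) \<le> 0" "l * yield (pres \<sigma>, u) = 0"
    using sys unfolding return_system_def fy by auto
  \<comment> \<open>Equal pressures would make the result the trial stress, which is inadmissible.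
    Hence \<open>l > 0\<close>, and complementarity puts the pressure at the root of
    \<open>yield\<close>.\<close>
  have "pres \<sigma> \<noteq> pres u"
  proof
    assume "pres \<sigma> = pres u"
    with fhat_ret[OF u, of "pres u"] y(1) f show False by (simp add: ret_pres)
  qed
  with s(3) have "l > 0" unfolding s(2) plastic_mult_def using pos by simp
  with y(2) have "pres \<sigma> = pstar u" by (simp add: yield_eq_0_iff)
  with s(1,2) show ?thesis by simp
qed

text \<open>Monotonicity of \<open>yield\<close> turns the sign test at the trial stress into a
  comparison of \<open>pres u\<close> with \<open>pstar u\<close>. The minimum therefore selects the
  correct branch, and \<open>ret u (pres u)\<close> is the trial stress.\<close>

lemma Tmap_eq_ret:
  assumes eps: "\<epsilon> \<in> Sym3" "epsp \<in> Sym3"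
  defines "u \<equiv> De K G (\<epsilon> - epsp)"
  shows "Tmap K G m0 Ag Bg fc ft e epsp \<epsilon> = ret u (min (pres u) (pstar u))"
proof -
  have u: "u \<in> Sym3" unfolding u_def by (intro De_in_Sym3 Sym3_closed eps)
  have fu: "fhat m0 fc (pres u) (rho u) (rho_e e u) = yield (pres u, u)"
    using fhat_ret[OF u, of "pres u"] by (simp add: ret_pres)
  show ?thesis
  proof (cases "yield (pres u, u) \<le> 0")
    case True
    have "pres u \<le> pstar u"
    proof (rule ccontr)
      assume "\<not> pres u \<le> pstar u"
      then have "yield (pres u, u) = 0"
        using True yield_mono[of "pstar u" "pres u" u] yield_pstar[of u] by simp
      with \<open>\<not> pres u \<le> pstar u\<close> show False by (simp add: yield_eq_0_iff)
    qed
    then show ?thesis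
      using True unfolding Tmap_def u_def[symmetric] Let_def fu by (simp add: min_def ret_pres)
  next
    case False
    then have p: "pstar u < pres u"
      using yield_mono[of "pres u" "pstar u" u] yield_pstar[of u] by (cases "pres u \<le> pstar u") auto
    have "(THE sl. return_system K G m0 Ag Bg fc ft e u (fst sl) (snd sl)) = (ret u (pstar u), plastic_mult (pstar u) u)"
    proof (rule the_equality)
      show "return_system K G m0 Ag Bg fc ft e u (fst (ret u (pstar u), plastic_mult (pstar u) u))
          (snd (ret u (pstar u), plastic_mult (pstar u) u))"
        using return_system_ret[OF u p yield_pstar] by simp
      show "sl = (ret u (pstar u), plastic_mult (pstar u) u)"
        if "return_system K G m0 Ag Bg fc ft e u (fst sl) (snd sl)" for sl
        using return_system_unique[OF u _ that] False fu by (auto simp: prod_eq_iff)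
    qed
    then show ?thesis
      using False p unfolding Tmap_def u_def[symmetric] Let_def fu by (simp add: min_def)
  qed
qed

lemma strongly_semismooth_Tmap:
  assumes "epsp \<in> Sym3"
  shows "strongly_semismooth_on Sym3 (Tmap K G m0 Ag Bg fc ft e epsp)"
  unfolding strongly_semismooth_on_def
proof
  fix x :: mat3 assume x: "x \<in> Sym3"
  let ?u = "\<lambda>\<epsilon>. De K G (\<epsilon> - epsp)"
  have u: "ssd_at ?u x" by (intro ssd_at_De ssd_at_diff ssd_at_ident ssd_at_const)
  have "ssd_at (\<lambda>\<epsilon>. ret (?u \<epsilon>) (min (pres (?u \<epsilon>)) (pstar (?u \<epsilon>)))) x"
    by (intro ssd_at_ret ssd_at_min ssd_at_pres u ssd_at_compose[OF ssd_at_pstar u])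
  from ssd_at_imp_strongly_semismooth_at[OF subspace_Sym3 Tmap_eq_ret[OF _ assms] x this]
  show "strongly_semismooth_at Sym3 (Tmap K G m0 Ag Bg fc ft e epsp) x" .
qed

end

theorem theorem7:
  fixes K G m0 Ag Bg fc ft e :: real and epsp :: mat3
  assumes "K > 0" "G > 0" "m0 > 0" "Ag > 0" "Bg > 0" "fc > 0" "ft > 0"
    and "e \<in> {0.5..1}"
    and "epsp \<in> Sym3"
  shows "strongly_semismooth_on Sym3 (Tmap K G m0 Ag Bg fc ft e epsp)"
proof -
  interpret return_mapping K G m0 Ag Bg fc ft e
    by unfold_locales (use assms in auto)
  show ?thesis using assms by (intro strongly_semismooth_Tmap)
qed

end
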